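(* If $G$ is a finite group, $k$ is a field, and $V$ is a faithful representation of $G$ over $k$ of finite dimension $n$, then $$\binom{D_{\mathrm{span}}(G,V) + n}{n}\geq \binom{D_{\mathrm{reg}}(G,V) + n}{n} \geq |G|.$$
   Context: $k[V]$ is the ring of polynomial functions on $V$ (the symmetric algebra of $V^*$), with $G$-action $(gf)(v)=f(g^{-1}v)$; $k(V)$ is its fraction field and $k(V)^G$ the field of $G$-invariant rational functions; $k[V]_{\le d}$ is the space of polynomials of degree at most $d$. All minima are over $d\in\mathbb{N}=\{0,1,2,\dots\}$. $D_{\mathrm{reg}}(G,V)$ is the minimum $d$ such that $k[V]_{\le d}$ contains a $kG$-submodule isomorphic to the regular representation $kG$. $D_{\mathrm{span}}(G,V)$ is the minimum $d$ such that $k[V]_{\le d}$ spans $k(V)$ as a $k(V)^G$-vector space. *)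

theory Defs
  imports
    Complex_Main
    "HOL-Library.Poly_Mapping"
    "HOL-Computational_Algebra.Fraction_Field"
    "HOL-Algebra.Group_Action"
begin

text \<open>
  Scalar multiplication on finitely supported functions. It serves both for polynomials and for
  the group algebra \<open>kG\<close>, whose elements are finitely supported functions on the group.
\<close>

definition pm_scale :: "'k::field \<Rightarrow> ('b \<Rightarrow>\<^sub>0 'k) \<Rightarrow> ('b \<Rightarrow>\<^sub>0 'k)" where
  "pm_scale c p = Poly_Mapping.map ((*) c) p"

lemma lookup_pm_scale [simp]: "Poly_Mapping.lookup (pm_scale c p) x = c * Poly_Mapping.lookup p x"
  by (simp add: pm_scale_def Poly_Mapping.map.rep_eq when_def)

lemma vector_space_pm_scale: "vector_space (pm_scale :: 'k::field \<Rightarrow> ('b \<Rightarrow>\<^sub>0 'k) \<Rightarrow> _)"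
  by (rule vector_space.intro) (auto intro!: poly_mapping_eqI simp: lookup_add algebra_simps)

text \<open>
  Throughout, \<open>V\<close> is the type \<open>'v\<close> with scalar multiplication \<open>scale\<close> and ordered basis
  \<open>b 0, \<dots>, b (n - 1)\<close>. The symmetric algebra \<open>k[V]\<close> of the dual space is the polynomial ring in
  the coordinate functions \<open>x\<^sub>0, \<dots>, x\<^sub>n\<^sub>-\<^sub>1\<close> of this basis. Its elements are formal polynomials, not
  functions, which matters when \<open>k\<close> is finite. They live in a type with countably many variables,
  so that \<open>n = 0\<close> is allowed.
\<close>

type_synonym 'k polynomials = "(nat \<Rightarrow>\<^sub>0 nat) \<Rightarrow>\<^sub>0 'k"

definition poly_var :: "nat \<Rightarrow> 'k::field polynomials" where
  "poly_var i = Poly_Mapping.single (Poly_Mapping.single i 1) 1"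

definition poly_ring :: "nat \<Rightarrow> 'k::field polynomials set" where
  "poly_ring n = {p. \<forall>m \<in> Poly_Mapping.keys p. Poly_Mapping.keys m \<subseteq> {..<n}}"

definition poly_ring_le :: "nat \<Rightarrow> nat \<Rightarrow> 'k::field polynomials set" where
  "poly_ring_le n d =
     {p \<in> poly_ring n. \<forall>m \<in> Poly_Mapping.keys p.
        (\<Sum>i \<in> Poly_Mapping.keys m. Poly_Mapping.lookup m i) \<le> d}"

definition poly_subst :: "(nat \<Rightarrow> 'k::field polynomials) \<Rightarrow> 'k polynomials \<Rightarrow> 'k polynomials" where
  "poly_subst s p = (\<Sum>m \<in> Poly_Mapping.keys p.
     pm_scale (Poly_Mapping.lookup p m) (\<Prod>i \<in> Poly_Mapping.keys m. s i ^ Poly_Mapping.lookup m i))"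

definition coord ::
  "('k::field \<Rightarrow> 'v::ab_group_add \<Rightarrow> 'v) \<Rightarrow> (nat \<Rightarrow> 'v) \<Rightarrow> nat \<Rightarrow> 'v \<Rightarrow> nat \<Rightarrow> 'k" where
  "coord scale b n v i = module.representation scale (b ` {..<n}) v (b i)"

text \<open>
  The action \<open>(g f)(v) = f (g\<^sup>-\<^sup>1 v)\<close>: it is the substitution sending the coordinate function
  \<open>x\<^sub>i\<close> to the linear form \<open>v \<mapsto> x\<^sub>i (g\<^sup>-\<^sup>1 v)\<close>, whose coefficient at \<open>x\<^sub>j\<close> is
  \<open>x\<^sub>i (g\<^sup>-\<^sup>1 b\<^sub>j)\<close>. Only its values on \<open>poly_ring n\<close> are meaningful.
\<close>

definition poly_act ::
  "('g, 'm) monoid_scheme \<Rightarrow> ('k::field \<Rightarrow> 'v::ab_group_add \<Rightarrow> 'v) \<Rightarrow> (nat \<Rightarrow> 'v) \<Rightarrow> nat \<Rightarrow>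
   ('g \<Rightarrow> 'v \<Rightarrow> 'v) \<Rightarrow> 'g \<Rightarrow> 'k polynomials \<Rightarrow> 'k polynomials" where
  "poly_act G scale b n \<rho> g =
     poly_subst (\<lambda>i. \<Sum>j<n. pm_scale (coord scale b n (\<rho> (inv\<^bsub>G\<^esub> g) (b j)) i) (poly_var j))"

text \<open>The field \<open>k(V)\<close>, as a subfield of the fraction field in countably many variables.\<close>

definition ratfuns :: "nat \<Rightarrow> 'k::field polynomials fract set" where
  "ratfuns n = {Fract p q | p q. p \<in> poly_ring n \<and> q \<in> poly_ring n \<and> q \<noteq> 0}"

text \<open>The induced action \<open>g (p / q) = (g p) / (g q)\<close> on \<open>k(V)\<close>.\<close>

definition ratfun_act ::
  "('g, 'm) monoid_scheme \<Rightarrow> ('k::field \<Rightarrow> 'v::ab_group_add \<Rightarrow> 'v) \<Rightarrow> (nat \<Rightarrow> 'v) \<Rightarrow> nat \<Rightarrow>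
   ('g \<Rightarrow> 'v \<Rightarrow> 'v) \<Rightarrow> 'g \<Rightarrow> 'k polynomials fract \<Rightarrow> 'k polynomials fract" where
  "ratfun_act G scale b n \<rho> g r =
     (THE s. \<exists>p \<in> poly_ring n. \<exists>q \<in> poly_ring n. q \<noteq> 0 \<and> r = Fract p q \<and>
        s = Fract (poly_act G scale b n \<rho> g p) (poly_act G scale b n \<rho> g q))"

definition invariant_ratfuns ::
  "('g, 'm) monoid_scheme \<Rightarrow> ('k::field \<Rightarrow> 'v::ab_group_add \<Rightarrow> 'v) \<Rightarrow> (nat \<Rightarrow> 'v) \<Rightarrow> nat \<Rightarrow>
   ('g \<Rightarrow> 'v \<Rightarrow> 'v) \<Rightarrow> 'k polynomials fract set" where
  "invariant_ratfuns G scale b n \<rho> =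
     {r \<in> ratfuns n. \<forall>g \<in> carrier G. ratfun_act G scale b n \<rho> g r = r}"

definition kG_submodule ::
  "('g, 'm) monoid_scheme \<Rightarrow> ('k::field \<Rightarrow> 'a::ab_group_add \<Rightarrow> 'a) \<Rightarrow> ('g \<Rightarrow> 'a \<Rightarrow> 'a) \<Rightarrow>
   'a set \<Rightarrow> bool" where
  "kG_submodule G scale act W \<longleftrightarrow>
     module.subspace scale W \<and> (\<forall>g \<in> carrier G. \<forall>w \<in> W. act g w \<in> W)"

definition kG_isomorphic ::
  "('g, 'm) monoid_scheme \<Rightarrow>
   ('k::field \<Rightarrow> 'a::ab_group_add \<Rightarrow> 'a) \<Rightarrow> ('g \<Rightarrow> 'a \<Rightarrow> 'a) \<Rightarrow> 'a set \<Rightarrow>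
   ('k \<Rightarrow> 'c::ab_group_add \<Rightarrow> 'c) \<Rightarrow> ('g \<Rightarrow> 'c \<Rightarrow> 'c) \<Rightarrow> 'c set \<Rightarrow> bool" where
  "kG_isomorphic G scale act U scale' act' W \<longleftrightarrow>
     (\<exists>\<phi>. bij_betw \<phi> U W \<and>
        (\<forall>u \<in> U. \<forall>v \<in> U. \<phi> (u + v) = \<phi> u + \<phi> v) \<and>
        (\<forall>c. \<forall>u \<in> U. \<phi> (scale c u) = scale' c (\<phi> u)) \<and>
        (\<forall>g \<in> carrier G. \<forall>u \<in> U. \<phi> (act g u) = act' g (\<phi> u)))"

text \<open>
  The regular representation: formal linear combinations of elements of \<open>G\<close>, on which \<open>g\<close> acts by
  sending each basis element \<open>h\<close> to \<open>g h\<close>.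
\<close>

definition regular_rep :: "('g, 'm) monoid_scheme \<Rightarrow> ('g \<Rightarrow>\<^sub>0 'k::field) set" where
  "regular_rep G = {a. Poly_Mapping.keys a \<subseteq> carrier G}"

definition regular_act :: "('g, 'm) monoid_scheme \<Rightarrow> 'g \<Rightarrow> ('g \<Rightarrow>\<^sub>0 'k::field) \<Rightarrow> ('g \<Rightarrow>\<^sub>0 'k)" where
  "regular_act G g a =
     (\<Sum>h \<in> Poly_Mapping.keys a. Poly_Mapping.single (g \<otimes>\<^bsub>G\<^esub> h) (Poly_Mapping.lookup a h))"

definition D_reg ::
  "('g, 'm) monoid_scheme \<Rightarrow> ('k::field \<Rightarrow> 'v::ab_group_add \<Rightarrow> 'v) \<Rightarrow> (nat \<Rightarrow> 'v) \<Rightarrow> nat \<Rightarrow>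
   ('g \<Rightarrow> 'v \<Rightarrow> 'v) \<Rightarrow> nat" where
  "D_reg G scale b n \<rho> =
     (LEAST d. \<exists>W \<subseteq> (poly_ring_le n d :: 'k polynomials set).
        kG_submodule G pm_scale (poly_act G scale b n \<rho>) W \<and>
        kG_isomorphic G
          pm_scale (regular_act G) (regular_rep G :: ('g \<Rightarrow>\<^sub>0 'k) set)
          pm_scale (poly_act G scale b n \<rho>) W)"

definition D_span ::
  "('g, 'm) monoid_scheme \<Rightarrow> ('k::field \<Rightarrow> 'v::ab_group_add \<Rightarrow> 'v) \<Rightarrow> (nat \<Rightarrow> 'v) \<Rightarrow> nat \<Rightarrow>
   ('g \<Rightarrow> 'v \<Rightarrow> 'v) \<Rightarrow> nat" where
  "D_span G scale b n \<rho> =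
     (LEAST d. \<forall>r \<in> (ratfuns n :: 'k polynomials fract set).
        \<exists>F c. finite F \<and> F \<subseteq> poly_ring_le n d \<and>
          (\<forall>f \<in> F. c f \<in> invariant_ratfuns G scale b n \<rho>) \<and>
          r = (\<Sum>f \<in> F. c f * Fract f 1))"

end

theory Submission
  imports Defs
begin

text \<open>
  The polynomials of degree at most \<open>d\<close>, denoted \<open>M\<close>, span \<open>k(V)\<close> over the invariants if and only if there
  is no nontrivial relation \<open>\<Sum>\<^sub>g \<lambda>\<^sub>g (g f) = 0\<close> with coefficients \<open>\<lambda>\<^sub>g\<close> in \<open>k(V)\<close> valid for all
  \<open>f \<in> M\<close>. Under this condition, for every left ideal \<open>T\<close> of \<open>kG\<close> the maps \<open>x \<mapsto> x f\<close>, \<open>f \<in> M\<close>, from \<open>T\<close>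
  to \<open>M\<close> form a space of dimension at least \<open>dim T\<close>: otherwise a combination of a basis of \<open>T\<close> over
  \<open>k(V)\<close> would kill \<open>M\<close>. Since \<open>kG\<close> is self-injective, the module homomorphisms from \<open>T\<close> to \<open>kG\<close> have
  dimension exactly \<open>dim T\<close>. Comparing the two shows that, as long as the annihilator of \<open>f \<in> M\<close> meets the
  socle of \<open>kG\<close>, it can be made smaller by changing \<open>f\<close>. Hence some \<open>f \<in> M\<close> has zero annihilator, and
  \<open>kG f\<close> is a regular submodule of \<open>M\<close>. No genericity is used, so \<open>k\<close> may be finite and its
  characteristic may divide the group order. The second inequality compares dimensions.
\<close>

section \<open>Linear algebra\<close>

text \<open>Gaussian elimination with cross-multiplication instead of division keeps the solution
  inside the domain. It is applied to polynomial coefficients, so no passage to the fraction field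
  is required.\<close>

lemma homogeneous_system_nontrivial_solution:
  fixes c :: "'i \<Rightarrow> 'j \<Rightarrow> 'a::idom"
  assumes "finite J" "finite I" "card J < card I"
  shows "\<exists>l. (\<exists>i\<in>I. l i \<noteq> 0) \<and> (\<forall>j\<in>J. (\<Sum>i\<in>I. l i * c i j) = 0)"
  using assms
proof (induction J arbitrary: I c rule: finite_induct)
  case empty
  then obtain i where "i \<in> I" by fastforce
  then show ?case by (intro exI[of _ "\<lambda>_. 1"]) auto
next
  case (insert j J)
  show ?case
  proof (cases "\<forall>i\<in>I. c i j = 0")
    case True
    obtain l where "\<exists>i\<in>I. l i \<noteq> 0" "\<forall>j\<in>J. (\<Sum>i\<in>I. l i * c i j) = 0"
      using insert.IH[of I c] insert.prems insert.hyps by auto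
    then show ?thesis using True by (intro exI[of _ l]) auto
  next
    case False
    then obtain k where k: "k \<in> I" "c k j \<noteq> 0" by blast
    \<comment> \<open>\<open>d\<close> is the system after eliminating the unknown \<open>k\<close>
      with pivot \<open>c k j\<close>. A solution of it is lifted by multiplying it by the pivot and
      solving equation \<open>j\<close> for the unknown \<open>k\<close>.\<close>
    define d where "d i j' = c k j * c i j' - c i j * c k j'" for i j'
    have "card J < card (I - {k})" using insert.prems insert.hyps k by simp
    then obtain l where l: "\<exists>i\<in>I - {k}. l i \<noteq> 0"
      "\<forall>j\<in>J. (\<Sum>i\<in>I - {k}. l i * d i j) = 0"
      using insert.IH[of "I - {k}" d] insert.prems by auto
    define l' where "l' i = (if i = k then - (\<Sum>i\<in>I - {k}. l i * c i j) else l i * c k j)" for i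
    have split: "(\<Sum>i\<in>I. l' i * c i j') = (\<Sum>i\<in>I - {k}. l i * d i j')" for j'
    proof -
      have "(\<Sum>i\<in>I. l' i * c i j') = l' k * c k j' + (\<Sum>i\<in>I - {k}. l' i * c i j')"
        using k insert.prems by (simp add: sum.remove)
      also have "(\<Sum>i\<in>I - {k}. l' i * c i j') = (\<Sum>i\<in>I - {k}. l i * c k j * c i j')"
        by (intro sum.cong) (auto simp: l'_def)
      finally show ?thesis
        by (simp add: l'_def d_def sum_distrib_right sum_distrib_left sum_negf sum_subtractf algebra_simps)
    qed
    have "\<exists>i\<in>I. l' i \<noteq> 0" using l(1) k by (auto simp: l'_def)
    moreover have "(\<Sum>i\<in>I - {k}. l i * d i j) = 0" by (simp add: d_def)
    ultimately show ?thesis using l(2) split by (intro exI[of _ l']) auto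
  qed
qed

lemma vector_space_mult: "vector_space ((*) :: 'k::field \<Rightarrow> 'k \<Rightarrow> 'k)"
  by (simp add: vector_space_def algebra_simps)

context vector_space
begin

text \<open>A basis of \<open>U\<close> together with a vector of \<open>W\<close> outside
  \<open>U\<close> extends to a basis of \<open>W\<close>. The ambient space may be
  infinite-dimensional; finiteness comes from \<open>B\<close>.\<close>

lemma dim_psubset_span_finite:
  assumes "finite B" "W \<subseteq> span B" "subspace U" "U \<subset> W"
  shows "dim U < dim W"
proof -
  obtain K where K: "K \<subseteq> U" "independent K" "U \<subseteq> span K" "card K = dim U"
    using basis_exists[of U] by blast
  have UK: "span K = U" using K assms(3) span_subspace by blast
  obtain x where x: "x \<in> W" "x \<notin> U" using assms(4) by blast
  have ind: "independent (insert x K)" using K UK x by (simp add: independent_insertI)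
  have sub: "insert x K \<subseteq> W" using x K assms(4) by blast
  obtain L where L: "insert x K \<subseteq> L" "L \<subseteq> W" "independent L" "W \<subseteq> span L"
    using maximal_independent_subset_extend[OF sub ind] by blast
  have finL: "finite L" using independent_span_bound[OF assms(1) L(3)] L(2) assms(2) by blast
  have "x \<notin> K" using K x by blast
  moreover have "finite K" using finL L(1) finite_subset by auto
  ultimately have "card K < card L"
    using card_mono[OF finL L(1)] by simp
  then show ?thesis using K basis_card_eq_dim[OF L(2) L(4) L(3)] by simp
qed

text \<open>Among the subspaces satisfying \<open>P\<close>, one of least dimension is minimal for
  inclusion. This and the maximal version below serve as chain conditions for left ideals.\<close>

lemma subspace_minimal_exists:
  assumes "finite B" "\<And>U. P U \<Longrightarrow> subspace U \<and> U \<subseteq> span B" "P U0"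
  shows "\<exists>U. P U \<and> (\<forall>W. P W \<longrightarrow> W \<subseteq> U \<longrightarrow> W = U)"
proof -
  obtain U where U: "P U" "\<And>W. P W \<Longrightarrow> dim U \<le> dim W"
    using ex_has_least_nat[of P U0 dim] assms(3) by blast
  have "W = U" if "P W" "W \<subseteq> U" for W
    using dim_psubset_span_finite[OF assms(1), of U W] U assms(2) that
    by (metis leD psubsetI)
  then show ?thesis using U by blast
qed

lemma subspace_maximal_exists:
  assumes "finite B" "\<And>U. P U \<Longrightarrow> subspace U \<and> U \<subseteq> span B" "P U0"
  shows "\<exists>U. P U \<and> (\<forall>W. P W \<longrightarrow> U \<subseteq> W \<longrightarrow> W = U)"
proof -
  have bd: "\<forall>W. P W \<longrightarrow> dim W < Suc (card B)"
    using assms(1,2) by (metis dim_le_card less_Suc_eq_le)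
  then obtain U where U: "P U" "\<And>W. P W \<Longrightarrow> dim W \<le> dim U"
    using ex_has_greatest_nat[of P U0 dim "Suc (card B)"] assms(3) by blast
  have "W = U" if "P W" "U \<subseteq> W" for W
    using dim_psubset_span_finite[OF assms(1), of W U] U assms(2) that
    by (metis leD psubsetI)
  then show ?thesis using U by blast
qed

lemma linear_functional_nonzero_exists:
  assumes "v \<noteq> 0"
  shows "\<exists>l. Vector_Spaces.linear scale (*) l \<and> l v \<noteq> 0"
proof -
  interpret vp: vector_space_pair scale "(*) :: 'a \<Rightarrow> 'a \<Rightarrow> 'a"
    by (rule vector_space_pair.intro[OF vector_space_axioms vector_space_mult])
  obtain l where "Vector_Spaces.linear scale (*) l" "\<forall>x\<in>{v}. l x = 1"
    using vp.linear_independent_extend[of "{v}" "\<lambda>_. 1"] assms by auto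
  then show ?thesis by (intro exI[of _ l]) auto
qed

text \<open>A basis of \<open>U\<close> determines \<open>f\<close> on \<open>U\<close>, and values
  on it can be prescribed for a functional on the whole space. This extension is the source of the
  self-injectivity of \<open>kG\<close>.\<close>

lemma linear_functional_extend:
  assumes U: "subspace U"
    and add: "\<And>x y. x \<in> U \<Longrightarrow> y \<in> U \<Longrightarrow> f (x + y) = f x + f y"
    and sc: "\<And>c x. x \<in> U \<Longrightarrow> f (scale c x) = c * f x"
  shows "\<exists>l. Vector_Spaces.linear scale (*) l \<and> (\<forall>x\<in>U. l x = f x)"
proof -
  interpret vp: vector_space_pair scale "(*) :: 'a \<Rightarrow> 'a \<Rightarrow> 'a"
    by (rule vector_space_pair.intro[OF vector_space_axioms vector_space_mult])
  obtain B where B: "B \<subseteq> U" "independent B" "U \<subseteq> span B"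
    using maximal_independent_subset[of U] by metis
  obtain l where l: "Vector_Spaces.linear scale (*) l" "\<forall>x\<in>B. l x = f x"
    using vp.linear_independent_extend[OF B(2), of f] by auto
  have f0: "f 0 = 0" using sc[of 0 0] U by (simp add: subspace_0)
  have "span B \<subseteq> {x \<in> U. l x = f x}"
  proof (rule span_minimal)
    show "B \<subseteq> {x \<in> U. l x = f x}" using B l by auto
    show "subspace {x \<in> U. l x = f x}"
      using U add sc f0 l(1) by (auto intro!: subspaceI simp: subspace_0 subspace_add subspace_scale
         vp.linear_0 vp.linear_add vp.linear_scale)
  qed
  then show ?thesis using l B by blast
qed

end

interpretation pm: vector_space "pm_scale :: 'k::field \<Rightarrow> ('b \<Rightarrow>\<^sub>0 'k) \<Rightarrow> _"
  by (rule vector_space_pm_scale)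

lemma pm_eq_sum_singles:
  assumes "finite A" "Poly_Mapping.keys p \<subseteq> A"
  shows "p = (\<Sum>a\<in>A. pm_scale (Poly_Mapping.lookup p a) (Poly_Mapping.single a (1::'k::field)))"
proof (rule poly_mapping_eqI)
  fix k
  have "(\<Sum>a\<in>A. Poly_Mapping.lookup p a * Poly_Mapping.lookup (Poly_Mapping.single a (1::'k)) k)
     = (\<Sum>a\<in>A. if k = a then Poly_Mapping.lookup p a else 0)"
    by (intro sum.cong) (auto simp: lookup_single when_def)
  also have "\<dots> = Poly_Mapping.lookup p k"
    using assms by (auto simp: sum.delta' in_keys_iff)
  finally show "Poly_Mapping.lookup p k = Poly_Mapping.lookup (\<Sum>a\<in>A. pm_scale (Poly_Mapping.lookup p a) (Poly_Mapping.single a 1)) k"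
    by (simp add: lookup_sum)
qed

lemma pm_span_singles:
  assumes "finite A"
  shows "pm.span ((\<lambda>a. Poly_Mapping.single a (1::'k::field)) ` A) = {p. Poly_Mapping.keys p \<subseteq> A}"
proof
  have "pm.subspace {p :: 'a \<Rightarrow>\<^sub>0 'k. Poly_Mapping.keys p \<subseteq> A}"
    by (rule pm.subspaceI) (auto simp: in_keys_iff lookup_add subset_eq)
  then show "pm.span ((\<lambda>a. Poly_Mapping.single a (1::'k::field)) ` A) \<subseteq> {p. Poly_Mapping.keys p \<subseteq> A}"
    by (intro pm.span_minimal) auto
  show "{p. Poly_Mapping.keys p \<subseteq> A} \<subseteq> pm.span ((\<lambda>a. Poly_Mapping.single a (1::'k::field)) ` A)"
  proof
    fix p :: "'a \<Rightarrow>\<^sub>0 'k" assume "p \<in> {p. Poly_Mapping.keys p \<subseteq> A}"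
    then have "p = (\<Sum>a\<in>A. pm_scale (Poly_Mapping.lookup p a) (Poly_Mapping.single a 1))"
      using pm_eq_sum_singles[OF assms] by blast
    then show "p \<in> pm.span ((\<lambda>a. Poly_Mapping.single a 1) ` A)"
      by (metis (no_types, lifting) image_eqI pm.span_base pm.span_scale pm.span_sum)
  qed
qed

section \<open>Representations of a finite group\<close>

text \<open>The laws are required on \<open>M\<close> only: for polynomials, \<open>act_one\<close>
  is available just within \<open>poly_ring n\<close>.\<close>

locale group_rep =
  group G + vector_space scale
  for G :: "('g, 'z) monoid_scheme" (structure)
    and scale :: "'k::field \<Rightarrow> 'm::ab_group_add \<Rightarrow> 'm" +
  fixes act :: "'g \<Rightarrow> 'm \<Rightarrow> 'm" and M :: "'m set"
  assumes finite_carrier: "finite (carrier G)"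
    and subspace_M: "subspace M"
    and act_closed: "\<lbrakk>g \<in> carrier G; x \<in> M\<rbrakk> \<Longrightarrow> act g x \<in> M"
    and act_add: "\<lbrakk>g \<in> carrier G; x \<in> M; y \<in> M\<rbrakk> \<Longrightarrow> act g (x + y) = act g x + act g y"
    and act_scale: "\<lbrakk>g \<in> carrier G; x \<in> M\<rbrakk> \<Longrightarrow> act g (scale c x) = scale c (act g x)"
    and act_one: "x \<in> M \<Longrightarrow> act \<one> x = x"
    and act_mult: "\<lbrakk>g \<in> carrier G; h \<in> carrier G; x \<in> M\<rbrakk> \<Longrightarrow> act (g \<otimes> h) x = act g (act h x)"
begin

definition alg_act :: "('g \<Rightarrow>\<^sub>0 'k) \<Rightarrow> 'm \<Rightarrow> 'm" where
  "alg_act a x = (\<Sum>g\<in>carrier G. scale (Poly_Mapping.lookup a g) (act g x))"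

lemma act_zero: "g \<in> carrier G \<Longrightarrow> act g 0 = 0"
  using act_add[of g 0 0] subspace_0[OF subspace_M] by simp

lemma act_uminus: "g \<in> carrier G \<Longrightarrow> x \<in> M \<Longrightarrow> act g (- x) = - act g x"
  using act_scale[of g x "-1"] by simp

lemma act_sum:
  assumes "g \<in> carrier G" "\<And>i. i \<in> I \<Longrightarrow> f i \<in> M"
  shows "act g (sum f I) = (\<Sum>i\<in>I. act g (f i))"
  using assms(2)
proof (induction I rule: infinite_finite_induct)
  case (insert i I)
  then show ?case using assms(1) subspace_sum[OF subspace_M, of I f] by (simp add: act_add)
qed (use assms(1) in \<open>auto simp: act_zero\<close>)

lemma alg_act_in_submodule:
  assumes "kG_submodule G scale act N" "x \<in> N"
  shows "alg_act a x \<in> N"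
  using assms unfolding alg_act_def kG_submodule_def
  by (auto intro!: subspace_sum subspace_scale)

lemma submodule_M: "kG_submodule G scale act M"
  using subspace_M act_closed by (auto simp: kG_submodule_def)

lemma alg_act_closed: "x \<in> M \<Longrightarrow> alg_act a x \<in> M"
  using alg_act_in_submodule[OF submodule_M] .

lemma alg_act_add_right: "x \<in> M \<Longrightarrow> y \<in> M \<Longrightarrow> alg_act a (x + y) = alg_act a x + alg_act a y"
  by (simp add: alg_act_def act_add scale_right_distrib sum.distrib)

lemma alg_act_scale_right: "x \<in> M \<Longrightarrow> alg_act a (scale c x) = scale c (alg_act a x)"
  by (simp add: alg_act_def act_scale scale_sum_right mult.commute)

lemma alg_act_zero_right: "alg_act a 0 = 0"
  by (simp add: alg_act_def act_zero)

lemma alg_act_zero_left: "alg_act 0 x = 0"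
  by (simp add: alg_act_def)

lemma alg_act_add_left: "alg_act (a + b) x = alg_act a x + alg_act b x"
  by (simp add: alg_act_def lookup_add scale_left_distrib sum.distrib)

lemma alg_act_scale_left: "alg_act (pm_scale c a) x = scale c (alg_act a x)"
  by (simp add: alg_act_def scale_sum_right)

lemma alg_act_uminus_left: "alg_act (- a) x = - alg_act a x"
  using alg_act_add_left[of a "-a" x] by (simp add: alg_act_zero_left add_eq_0_iff)

lemma alg_act_diff_left: "alg_act (a - b) x = alg_act a x - alg_act b x"
  using alg_act_add_left[of a "-b" x] by (simp add: alg_act_uminus_left)

end

section \<open>The regular representation\<close>

lemma subspace_regular_rep: "pm.subspace (regular_rep G :: ('g \<Rightarrow>\<^sub>0 'k::field) set)"
  by (rule pm.subspaceI) (auto simp: regular_rep_def in_keys_iff lookup_add subset_eq)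

lemma (in group) lookup_regular_act:
  assumes "a \<in> (regular_rep G :: ('a \<Rightarrow>\<^sub>0 'k::field) set)" "g \<in> carrier G"
  shows "Poly_Mapping.lookup (regular_act G g a) h =
    (if h \<in> carrier G then Poly_Mapping.lookup a (inv g \<otimes> h) else 0)"
proof -
  have keys: "Poly_Mapping.keys a \<subseteq> carrier G" using assms by (simp add: regular_rep_def)
  have "Poly_Mapping.lookup (regular_act G g a) h =
     (\<Sum>l\<in>Poly_Mapping.keys a. if g \<otimes> l = h then Poly_Mapping.lookup a l else 0)"
    by (simp add: regular_act_def lookup_sum lookup_single when_def)
  also have "\<dots> = (if h \<in> carrier G then Poly_Mapping.lookup a (inv g \<otimes> h) else 0)"
  proof (cases "h \<in> carrier G")
    case True
    then have "g \<otimes> l = h \<longleftrightarrow> l = inv g \<otimes> h" if "l \<in> Poly_Mapping.keys a" for l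
      using that keys assms(2) inv_solve_left[of l g h] by auto
    then have "(\<Sum>l\<in>Poly_Mapping.keys a. if g \<otimes> l = h then Poly_Mapping.lookup a l else 0)
      = (\<Sum>l\<in>Poly_Mapping.keys a. if l = inv g \<otimes> h then Poly_Mapping.lookup a l else 0)"
      by (intro sum.cong) auto
    then show ?thesis using True by (auto simp: in_keys_iff)
  next
    case False
    then have "g \<otimes> l \<noteq> h" if "l \<in> Poly_Mapping.keys a" for l
      using that keys assms(2) by (metis m_closed subsetD)
    then show ?thesis using False by (auto intro!: sum.neutral)
  qed
  finally show ?thesis .
qed

lemma (in group) group_rep_regular:
  assumes "finite (carrier G)"
  shows "group_rep G (pm_scale :: 'k::field \<Rightarrow> _) (regular_act G) (regular_rep G)"
proof (intro group_rep.intro group_rep_axioms.intro)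
  show closed: "regular_act G g x \<in> regular_rep G"
    if "g \<in> carrier G" "x \<in> (regular_rep G :: ('a \<Rightarrow>\<^sub>0 'k) set)" for g and x
    using lookup_regular_act[OF that(2,1)]
    by (auto simp: regular_rep_def in_keys_iff split: if_splits)
  show "pm.subspace (regular_rep G :: ('a \<Rightarrow>\<^sub>0 'k) set)" by (rule subspace_regular_rep)
  note sub = this
  fix g h and x y :: "'a \<Rightarrow>\<^sub>0 'k" and c :: 'k
  assume g: "g \<in> carrier G" and x: "x \<in> regular_rep G"
  show "regular_act G (g \<otimes> h) x = regular_act G g (regular_act G h x)" if "h \<in> carrier G"
    using g x that closed by (intro poly_mapping_eqI) (simp add: lookup_regular_act inv_mult_group m_assoc)
  show "regular_act G g (pm_scale c x) = pm_scale c (regular_act G g x)"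
    using g x sub by (intro poly_mapping_eqI) (simp add: lookup_regular_act pm.subspace_scale)
  show "regular_act G g (x + y) = regular_act G g x + regular_act G g y" if "y \<in> regular_rep G"
    using g x that sub by (intro poly_mapping_eqI) (simp add: lookup_regular_act pm.subspace_add lookup_add)
next
  fix x :: "'a \<Rightarrow>\<^sub>0 'k" assume x: "x \<in> regular_rep G"
  show "regular_act G \<one> x = x"
  proof (rule poly_mapping_eqI)
    fix k show "Poly_Mapping.lookup (regular_act G \<one> x) k = Poly_Mapping.lookup x k"
      using x lookup_regular_act[OF x one_closed] by (auto simp: regular_rep_def in_keys_iff subset_eq)
  qed
qed (use assms in \<open>auto intro: vector_space_pm_scale group_axioms\<close>)

context group_rep
begin

text \<open>Left translation by \<open>g\<close> permutes the group, so the sum can be reindexed.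
  The map \<open>a \<mapsto> a x\<close> thereby becomes a module homomorphism from
  \<open>kG\<close> to \<open>M\<close>.\<close>

lemma alg_act_regular_act:
  assumes "g \<in> carrier G" "a \<in> regular_rep G" "x \<in> M"
  shows "alg_act (regular_act G g a) x = act g (alg_act a x)"
proof -
  have bij: "bij_betw (\<lambda>h. g \<otimes> h) (carrier G) (carrier G)"
    using assms(1) by (intro bij_betwI[of _ _ _ "\<lambda>h. inv g \<otimes> h"]) (auto simp: m_assoc[symmetric])
  have "alg_act (regular_act G g a) x
      = (\<Sum>h\<in>carrier G. scale (Poly_Mapping.lookup (regular_act G g a) (g \<otimes> h)) (act (g \<otimes> h) x))"
    unfolding alg_act_def by (rule sum.reindex_bij_betw[OF bij, symmetric])
  also have "\<dots> = (\<Sum>h\<in>carrier G. act g (scale (Poly_Mapping.lookup a h) (act h x)))"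
    using assms by (intro sum.cong)
      (auto simp: lookup_regular_act m_assoc[symmetric] act_mult act_scale act_closed)
  also have "\<dots> = act g (alg_act a x)"
    unfolding alg_act_def using assms by (intro act_sum[symmetric])
     (auto intro: act_closed subspace_scale subspace_M)
  finally show ?thesis .
qed

lemma alg_act_sum_left: "alg_act (sum f I) x = (\<Sum>i\<in>I. alg_act (f i) x)"
  by (induction I rule: infinite_finite_induct) (auto simp: alg_act_zero_left alg_act_add_left)

end

text \<open>The product of \<open>kG\<close> is its action on the regular representation, so the
  laws of \<open>alg_act\<close> apply to products as well.\<close>

abbreviation alg_mult ::
  "('g, 'z) monoid_scheme \<Rightarrow> ('g \<Rightarrow>\<^sub>0 'k::field) \<Rightarrow> ('g \<Rightarrow>\<^sub>0 'k) \<Rightarrow> ('g \<Rightarrow>\<^sub>0 'k)" (infixl "\<star>\<index>" 70)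
  where "a \<star>\<^bsub>G\<^esub> b \<equiv> group_rep.alg_act G pm_scale (regular_act G) a b"

context group_rep
begin

interpretation reg: group_rep G "pm_scale :: 'k \<Rightarrow> _" "regular_act G" "regular_rep G"
  by (rule group_rep_regular[OF finite_carrier])

abbreviation alg :: "('g \<Rightarrow>\<^sub>0 'k) set" where "alg \<equiv> regular_rep G"

definition left_ideal :: "('g \<Rightarrow>\<^sub>0 'k) set \<Rightarrow> bool" where
  "left_ideal I \<longleftrightarrow> I \<subseteq> alg \<and> kG_submodule G pm_scale (regular_act G) I"

lemma alg_act_alg_mult:
  assumes "b \<in> alg" "x \<in> M"
  shows "alg_act (a \<star> b) x = alg_act a (alg_act b x)"
  unfolding reg.alg_act_def
  using assms by (simp add: alg_act_sum_left alg_act_scale_left alg_act_regular_act)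
    (simp add: alg_act_def)

lemma single_in_alg: "g \<in> carrier G \<Longrightarrow> Poly_Mapping.single g c \<in> alg"
  by (simp add: regular_rep_def)

lemma finite_singles: "finite ((\<lambda>g. Poly_Mapping.single g (1::'k)) ` carrier G)"
  using finite_carrier by simp

lemma alg_span: "alg = pm.span ((\<lambda>g. Poly_Mapping.single g 1) ` carrier G)"
  using pm_span_singles[OF finite_carrier, symmetric] by (simp add: regular_rep_def)

text \<open>This bilinear form in \<open>u\<close> and \<open>a\<close> makes \<open>kG\<close> a
  Frobenius algebra: it pairs each \<open>g\<close> with its inverse. Together with
  \<open>lookup_via_one\<close> it recovers a product from the coefficients at \<open>\<one>\<close>
  of its translates.\<close>

lemma lookup_alg_mult_one:
  "Poly_Mapping.lookup (u \<star> a) \<one> =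
    (\<Sum>g\<in>carrier G. Poly_Mapping.lookup u g * Poly_Mapping.lookup a (inv g))" if "a \<in> alg"
  unfolding reg.alg_act_def using that
  by (auto simp: lookup_sum lookup_regular_act intro!: sum.cong)

lemma lookup_via_one:
  assumes "x \<in> alg" "h \<in> carrier G"
  shows "Poly_Mapping.lookup x h = Poly_Mapping.lookup (regular_act G (inv h) x) \<one>"
  using assms by (simp add: lookup_regular_act)

lemma alg_eqI:
  assumes "x \<in> alg" "y \<in> alg" "\<And>h. h \<in> carrier G \<Longrightarrow> Poly_Mapping.lookup x h = Poly_Mapping.lookup y h"
  shows "x = y"
proof (rule poly_mapping_eqI)
  have keys: "Poly_Mapping.keys x \<subseteq> carrier G" "Poly_Mapping.keys y \<subseteq> carrier G"
    using assms(1,2) by (simp_all add: regular_rep_def)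
  fix h show "Poly_Mapping.lookup x h = Poly_Mapping.lookup y h"
    using assms(3)[of h] keys by (metis in_keys_iff subsetD)
qed

text \<open>The group algebra is self-injective: composing with the coefficient at \<open>\<one>\<close> identifies
  module homomorphisms into it with linear functionals, and functionals extend.\<close>

lemma module_hom_is_right_mult:
  assumes U: "left_ideal U"
    and cl: "\<And>u. u \<in> U \<Longrightarrow> \<psi> u \<in> alg"
    and add: "\<And>u v. u \<in> U \<Longrightarrow> v \<in> U \<Longrightarrow> \<psi> (u + v) = \<psi> u + \<psi> v"
    and sc: "\<And>c u. u \<in> U \<Longrightarrow> \<psi> (pm_scale c u) = pm_scale c (\<psi> u)"
    and eq: "\<And>g u. g \<in> carrier G \<Longrightarrow> u \<in> U \<Longrightarrow> \<psi> (regular_act G g u) = regular_act G g (\<psi> u)"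
  shows "\<exists>a\<in>alg. \<forall>u\<in>U. u \<star> a = \<psi> u"
proof -
  have sU: "pm.subspace U" and UA: "U \<subseteq> alg"
    and Ug: "\<And>g u. g \<in> carrier G \<Longrightarrow> u \<in> U \<Longrightarrow> regular_act G g u \<in> U"
    using U by (auto simp: left_ideal_def kG_submodule_def)
  obtain l where l: "Vector_Spaces.linear pm_scale (*) l"
    "\<forall>u\<in>U. l u = Poly_Mapping.lookup (\<psi> u) \<one>"
    using pm.linear_functional_extend[OF sU, of "\<lambda>u. Poly_Mapping.lookup (\<psi> u) \<one>"]
    by (auto simp: add sc lookup_add)
  interpret l: Vector_Spaces.linear pm_scale "(*)" l by (rule l)
  \<comment> \<open>The coefficients are placed at the inverses so that pairing with
    \<open>a\<close> through the coefficient at \<open>\<one>\<close> reproduces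
    \<open>l\<close>.\<close>
  define a where "a = (\<Sum>g\<in>carrier G. Poly_Mapping.single (inv g) (l (Poly_Mapping.single g 1)))"
  have aA: "a \<in> alg" unfolding a_def
    by (intro pm.subspace_sum[OF subspace_regular_rep] single_in_alg) auto
  have la: "Poly_Mapping.lookup a (inv g) = l (Poly_Mapping.single g 1)" if "g \<in> carrier G" for g
  proof -
    have "Poly_Mapping.lookup a (inv g) =
       (\<Sum>h\<in>carrier G. if h = g then l (Poly_Mapping.single g 1) else 0)"
      unfolding a_def lookup_sum using that
      by (intro sum.cong) (auto simp: lookup_single when_def dest: inj_onD[OF inv_inj])
    then show ?thesis using that finite_carrier by simp
  qed
  have one: "Poly_Mapping.lookup (u \<star> a) \<one> = l u" if "u \<in> alg" for u
  proof -
    have "Poly_Mapping.keys u \<subseteq> carrier G" using that by (simp add: regular_rep_def)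
    then have "l u = l (\<Sum>g\<in>carrier G. pm_scale (Poly_Mapping.lookup u g) (Poly_Mapping.single g 1))"
      using pm_eq_sum_singles[OF finite_carrier, of u] by simp
    also have "\<dots> = (\<Sum>g\<in>carrier G. Poly_Mapping.lookup u g * l (Poly_Mapping.single g 1))"
      by (simp add: l.sum l.scale)
    finally show ?thesis using aA by (simp add: lookup_alg_mult_one la)
  qed
  have "u \<star> a = \<psi> u" if u: "u \<in> U" for u
  proof (rule alg_eqI)
    show "u \<star> a \<in> alg" "\<psi> u \<in> alg" using u cl aA by (auto intro: reg.alg_act_closed)
    fix h assume h: "h \<in> carrier G"
    have hu: "regular_act G (inv h) u \<in> U" using Ug u h by simp
    \<comment> \<open>Translating by \<open>inv h\<close> moves the coefficient at \<open>h\<close>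
      to \<open>\<one>\<close>, where it is known because \<open>U\<close> is stable under the
      group.\<close>
    have "Poly_Mapping.lookup (u \<star> a) h = Poly_Mapping.lookup (regular_act G (inv h) u \<star> a) \<one>"
      using h u UA aA by (subst reg.alg_act_regular_act) (auto intro!: lookup_via_one reg.alg_act_closed)
    also have "\<dots> = Poly_Mapping.lookup (\<psi> (regular_act G (inv h) u)) \<one>"
      using hu UA one l(2) by auto
    also have "\<dots> = Poly_Mapping.lookup (\<psi> u) h"
      using h u cl eq by (simp add: lookup_via_one[of "\<psi> u"])
    finally show "Poly_Mapping.lookup (u \<star> a) h = Poly_Mapping.lookup (\<psi> u) h" .
  qed
  then show ?thesis using aA by blast
qed

end

section \<open>The socle of the group algebra\<close>

context group_rep
begin

interpretation reg: group_rep G "pm_scale :: 'k \<Rightarrow> _" "regular_act G" "regular_rep G"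
  by (rule group_rep_regular[OF finite_carrier])

definition minimal_left_ideal :: "('g \<Rightarrow>\<^sub>0 'k) set \<Rightarrow> bool" where
  "minimal_left_ideal T \<longleftrightarrow> left_ideal T \<and> T \<noteq> {0} \<and>
     (\<forall>U. left_ideal U \<longrightarrow> U \<subseteq> T \<longrightarrow> U = {0} \<or> U = T)"

definition socle :: "('g \<Rightarrow>\<^sub>0 'k) set" where
  "socle = pm.span (\<Union>{T. minimal_left_ideal T})"

lemma minimal_left_idealD:
  assumes "minimal_left_ideal T" "left_ideal U" "U \<subseteq> T"
  shows "U = {0} \<or> U = T"
  using assms unfolding minimal_left_ideal_def by blast

lemma left_idealI:
  assumes "I \<subseteq> alg" "0 \<in> I" "\<And>x y. x \<in> I \<Longrightarrow> y \<in> I \<Longrightarrow> x + y \<in> I"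
    "\<And>c x. x \<in> I \<Longrightarrow> pm_scale c x \<in> I"
    "\<And>g x. g \<in> carrier G \<Longrightarrow> x \<in> I \<Longrightarrow> regular_act G g x \<in> I"
  shows "left_ideal I"
  using assms by (auto simp: left_ideal_def kG_submodule_def intro!: pm.subspaceI)

lemma left_idealD:
  assumes "left_ideal I"
  shows "I \<subseteq> alg" "0 \<in> I" "\<And>x y. x \<in> I \<Longrightarrow> y \<in> I \<Longrightarrow> x + y \<in> I"
    "\<And>x y. x \<in> I \<Longrightarrow> y \<in> I \<Longrightarrow> x - y \<in> I"
    "\<And>c x. x \<in> I \<Longrightarrow> pm_scale c x \<in> I"
    "\<And>g x. g \<in> carrier G \<Longrightarrow> x \<in> I \<Longrightarrow> regular_act G g x \<in> I"
    "pm.subspace I"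
  using assms by (auto simp: left_ideal_def kG_submodule_def pm.subspace_0 pm.subspace_add pm.subspace_scale pm.subspace_diff)

lemma left_ideal_inter: "left_ideal I \<Longrightarrow> left_ideal J \<Longrightarrow> left_ideal (I \<inter> J)"
  by (auto simp: left_ideal_def kG_submodule_def pm.subspace_inter)

lemma left_ideal_sum:
  assumes "left_ideal I" "left_ideal J"
  shows "left_ideal {x + y |x y. x \<in> I \<and> y \<in> J}"
proof -
  note ID = left_idealD[OF assms(1)] and JD = left_idealD[OF assms(2)]
  show ?thesis
  proof (rule left_idealI)
    show "{x + y |x y. x \<in> I \<and> y \<in> J} \<subseteq> alg"
      using ID(1) JD(1) by (auto intro!: pm.subspace_add[OF subspace_regular_rep])
    show "0 \<in> {x + y |x y. x \<in> I \<and> y \<in> J}"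
      using ID(2) JD(2) by force
  next
    fix u v assume "u \<in> {x + y |x y. x \<in> I \<and> y \<in> J}" "v \<in> {x + y |x y. x \<in> I \<and> y \<in> J}"
    then show "u + v \<in> {x + y |x y. x \<in> I \<and> y \<in> J}"
      using pm.subspace_add[OF pm.subspace_sums[OF ID(7) JD(7)]] by blast
  next
    fix c u assume "u \<in> {x + y |x y. x \<in> I \<and> y \<in> J}"
    then show "pm_scale c u \<in> {x + y |x y. x \<in> I \<and> y \<in> J}"
      using pm.subspace_scale[OF pm.subspace_sums[OF ID(7) JD(7)]] by blast
  next
    fix g u assume g: "g \<in> carrier G" and "u \<in> {x + y |x y. x \<in> I \<and> y \<in> J}"
    then obtain x y where u: "u = x + y" "x \<in> I" "y \<in> J" by blast
    then have "regular_act G g u = regular_act G g x + regular_act G g y"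
      using g ID(1) JD(1) by (auto intro!: reg.act_add)
    then show "regular_act G g u \<in> {x + y |x y. x \<in> I \<and> y \<in> J}"
      using u g ID(6) JD(6) by blast
  qed
qed

lemma minimal_left_ideal_subset_socle: "minimal_left_ideal T \<Longrightarrow> T \<subseteq> socle"
  unfolding socle_def by (rule order_trans[OF _ pm.span_superset]) blast

lemma left_ideal_socle: "left_ideal socle"
proof -
  let ?V = "\<Union>{T. minimal_left_ideal T}"
  have "?V \<subseteq> alg" unfolding minimal_left_ideal_def using left_idealD(1) by blast
  then have sub: "socle \<subseteq> alg"
    unfolding socle_def by (intro pm.span_minimal subspace_regular_rep)
  have sp: "pm.subspace socle" by (simp add: socle_def)
  have "regular_act G g x \<in> socle" if g: "g \<in> carrier G" and x: "x \<in> socle" for g x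
  proof -
    have "?V \<subseteq> {x \<in> socle. regular_act G g x \<in> socle}"
    proof
      fix x assume "x \<in> ?V"
      then obtain T where T: "minimal_left_ideal T" "x \<in> T" by blast
      then have "regular_act G g x \<in> T"
        using g left_idealD(6) by (simp add: minimal_left_ideal_def)
      then show "x \<in> {x \<in> socle. regular_act G g x \<in> socle}"
        using T minimal_left_ideal_subset_socle by blast
    qed
    moreover have "pm.subspace {x \<in> socle. regular_act G g x \<in> socle}"
      using sub sp g reg.act_zero[OF g] reg.act_add[OF g] reg.act_scale[OF g]
      by (intro pm.subspaceI) (auto simp: pm.subspace_0 pm.subspace_add pm.subspace_scale subset_eq)
    ultimately have "socle \<subseteq> {x \<in> socle. regular_act G g x \<in> socle}"
      by (subst socle_def) (rule pm.span_minimal)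
    then show ?thesis using x by blast
  qed
  then show ?thesis using sub sp by (simp add: left_ideal_def kG_submodule_def)
qed

lemma minimal_left_ideal_exists:
  assumes "left_ideal I" "I \<noteq> {0}"
  shows "\<exists>T\<subseteq>I. minimal_left_ideal T"
proof -
  obtain T where T: "left_ideal T \<and> T \<subseteq> I \<and> T \<noteq> {0}"
    "\<forall>W. left_ideal W \<and> W \<subseteq> I \<and> W \<noteq> {0} \<longrightarrow> W \<subseteq> T \<longrightarrow> W = T"
    using pm.subspace_minimal_exists[OF finite_singles, of "\<lambda>U. left_ideal U \<and> U \<subseteq> I \<and> U \<noteq> {0}" I]
      assms by (auto simp: left_ideal_def kG_submodule_def alg_span)
  then have "minimal_left_ideal T" unfolding minimal_left_ideal_def by blast
  then show ?thesis using T by blast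
qed

text \<open>Semisimplicity of the socle, in every characteristic: let \<open>C\<close> be maximal
  among the left ideals in the socle that meet \<open>U\<close> only in \<open>0\<close>. If a
  minimal \<open>T\<close> were not inside \<open>U + C\<close>, then \<open>C + T\<close> would be
  a larger choice.\<close>

lemma socle_complement_exists:
  assumes U: "left_ideal U" "U \<subseteq> socle"
  shows "\<exists>C. left_ideal C \<and> C \<subseteq> socle \<and> U \<inter> C = {0} \<and> (\<forall>x\<in>socle. \<exists>u\<in>U. \<exists>c\<in>C. x = u + c)"
proof -
  let ?P = "\<lambda>C. left_ideal C \<and> C \<subseteq> socle \<and> U \<inter> C = {0}"
  have zero: "left_ideal {0}"
    by (rule left_idealI) (auto simp: regular_rep_def reg.act_zero)
  obtain C where C: "?P C" "\<forall>W. ?P W \<longrightarrow> C \<subseteq> W \<longrightarrow> W = C"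
    using pm.subspace_maximal_exists[OF finite_singles, of ?P "{0}"] zero
      left_idealD(2)[OF U(1)] left_idealD(2)[OF left_ideal_socle]
    by (auto simp: left_ideal_def kG_submodule_def alg_span)
  define UC where "UC = {x + y |x y. x \<in> U \<and> y \<in> C}"
  have UC: "left_ideal UC" unfolding UC_def using left_ideal_sum U(1) C(1) by simp
  have UCI: "u + c \<in> UC" if "u \<in> U" "c \<in> C" for u c
    unfolding UC_def using that by blast
  have U0: "0 \<in> U" "0 \<in> C" using U C left_idealD(2) by auto
  have "T \<subseteq> UC" if T: "minimal_left_ideal T" for T
  proof (rule ccontr)
    assume nT: "\<not> T \<subseteq> UC"
    have lT: "left_ideal T" using T by (simp add: minimal_left_ideal_def)
    have "left_ideal (T \<inter> UC)" using left_ideal_inter lT UC by blast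
    then have "T \<inter> UC = {0} \<or> T \<inter> UC = T" by (rule minimal_left_idealD[OF T _ Int_lower1])
    then have int: "T \<inter> UC = {0}" using nT by blast
    let ?W = "{x + y |x y. x \<in> C \<and> y \<in> T}"
    have "left_ideal ?W" using left_ideal_sum lT C(1) by blast
    moreover have "?W \<subseteq> socle"
      using left_idealD(3)[OF left_ideal_socle] C(1) minimal_left_ideal_subset_socle[OF T] by auto
    \<comment> \<open>\<open>C + T\<close> still meets \<open>U\<close> trivially: writing
      \<open>x = c + t\<close> puts \<open>t\<close> into the intersection of \<open>T\<close> with
      \<open>U + C\<close>, so \<open>t = 0\<close>, and then \<open>x\<close> lies in both
      \<open>U\<close> and \<open>C\<close>.\<close>
    moreover have "x = 0" if x: "x \<in> U" "x \<in> ?W" for x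
    proof -
      obtain c t where ct: "c \<in> C" "t \<in> T" "x = c + t" using x by blast
      have "t = x + (- c)" using ct by simp
      moreover have "- c \<in> C" using pm.subspace_neg[OF left_idealD(7) ct(1)] C(1) by simp
      ultimately have "t \<in> UC" using x(1) UCI by metis
      then have "t \<in> T \<inter> UC" using ct(2) by (rule IntI[rotated])
      then have "t = 0" unfolding int by simp
      then show "x = 0" using ct x C(1) by auto
    qed
    moreover have "0 \<in> ?W" using U0 left_idealD(2)[OF lT] by force
    ultimately have "?P ?W" using U0 by blast
    moreover have "C \<subseteq> ?W" using left_idealD(2)[OF lT] by force
    ultimately have "?W = C" using C(2) by blast
    moreover have "T \<subseteq> ?W" using U0 by force
    ultimately have "T \<subseteq> C" by simp
    moreover have "C \<subseteq> UC" using UCI[OF U0(1)] by auto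
    ultimately show False using nT by blast
  qed
  then have "socle \<subseteq> UC" unfolding socle_def
    by (intro pm.span_minimal left_idealD(7)[OF UC]) auto
  then show ?thesis using C(1) unfolding UC_def by (intro exI[of _ C]) blast
qed

text \<open>The projection onto \<open>U\<close> along a complement in the socle is a module
  homomorphism, hence by self-injectivity right multiplication by an element of
  \<open>kG\<close>.\<close>

lemma socle_projection_exists:
  assumes U: "left_ideal U" "U \<subseteq> socle"
  shows "\<exists>e\<in>alg. (\<forall>x\<in>socle. x \<star> e \<in> U) \<and> (\<forall>x\<in>U. x \<star> e = x)"
proof -
  obtain C where C: "left_ideal C" "C \<subseteq> socle" "U \<inter> C = {0}"
    "\<forall>x\<in>socle. \<exists>u\<in>U. \<exists>c\<in>C. x = u + c"
    using socle_complement_exists[OF U] by blast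
  note UD = left_idealD[OF U(1)] and CD = left_idealD[OF C(1)]
  have "\<forall>x\<in>socle. \<exists>u. u \<in> U \<and> x - u \<in> C"
    using C(4) by (metis add_diff_cancel_left')
  then obtain p where p: "\<And>x. x \<in> socle \<Longrightarrow> p x \<in> U" "\<And>x. x \<in> socle \<Longrightarrow> x - p x \<in> C"
    by metis
  \<comment> \<open>Since the sum of \<open>U\<close> and \<open>C\<close> is direct, each law for
    \<open>p\<close> below follows once the proposed value is seen to be the component in
    \<open>U\<close>.\<close>
  have uniq: "p x = u" if "x \<in> socle" "u \<in> U" "x - u \<in> C" for x u
  proof -
    have "p x - u = (x - u) - (x - p x)" by simp
    then have "p x - u \<in> C" using CD(4) that p(2) by metis
    moreover have "p x - u \<in> U" using UD(4) that p(1) by blast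
    ultimately have "p x - u \<in> U \<inter> C" by simp
    then show ?thesis unfolding C(3) by simp
  qed
  have "\<exists>e\<in>alg. \<forall>x\<in>socle. x \<star> e = p x"
  proof (rule module_hom_is_right_mult[OF left_ideal_socle])
    fix x assume x: "x \<in> socle"
    show "p x \<in> alg" using p(1)[OF x] UD(1) by blast
    show "p (x + y) = p x + p y" if y: "y \<in> socle" for y
    proof (rule uniq)
      have "x + y - (p x + p y) = (x - p x) + (y - p y)" by simp
      then show "x + y - (p x + p y) \<in> C" using CD(3) p(2) x y by metis
    qed (use x y p UD left_idealD[OF left_ideal_socle] in auto)
    show "p (pm_scale c x) = pm_scale c (p x)" for c
    proof (rule uniq)
      have "pm_scale c x - pm_scale c (p x) = pm_scale c (x - p x)"
        by (simp add: pm.scale_right_diff_distrib)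
      then show "pm_scale c x - pm_scale c (p x) \<in> C" using CD(5) p(2) x by metis
    qed (use x p UD left_idealD[OF left_ideal_socle] in auto)
    show "p (regular_act G g x) = regular_act G g (p x)" if g: "g \<in> carrier G" for g
    proof (rule uniq)
      have "x \<in> alg" "- p x \<in> alg" "p x \<in> alg"
        using x p(1)[OF x] UD(1) left_idealD(1)[OF left_ideal_socle]
        by (auto intro!: pm.subspace_neg[OF subspace_regular_rep])
      then have "regular_act G g (x + - p x) = regular_act G g x - regular_act G g (p x)"
        using g by (simp only: reg.act_add reg.act_uminus) simp
      then show "regular_act G g x - regular_act G g (p x) \<in> C" using CD(6) p(2) x g by force
    qed (use x g p UD left_idealD[OF left_ideal_socle] in auto)
  qed
  moreover have "p x = x" if "x \<in> U" for x
    using that U CD(2) by (intro uniq) auto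
  ultimately show ?thesis using p(1) U(2) by (metis subsetD)
qed

lemma left_ideal_alg: "left_ideal alg"
  using reg.submodule_M by (simp add: left_ideal_def)

lemma left_ideal_annihilator: "f \<in> M \<Longrightarrow> left_ideal {a \<in> alg. alg_act a f = 0}"
  using left_idealD[OF left_ideal_alg]
  by (intro left_idealI)
    (auto simp: alg_act_zero_left alg_act_add_left alg_act_scale_left alg_act_regular_act act_zero)

end

section \<open>Vectors generating a regular representation\<close>

text \<open>The last assumption is the only trace left of the field \<open>k(V)\<close>: it says that the
  tuples \<open>(g f)\<^sub>g\<close>, \<open>f \<in> M\<close>, satisfy no linear relation over \<open>k(V)\<close>, denominators having been cleared
  from the coefficients \<open>l\<close>.\<close>

locale group_rep_idom = group_rep G scale act M
  for G :: "('g, 'z) monoid_scheme" (structure)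
    and scale :: "'k::field \<Rightarrow> 'm::idom \<Rightarrow> 'm"
    and act :: "'g \<Rightarrow> 'm \<Rightarrow> 'm" and M :: "'m set" +
  assumes mult_scale: "x * scale c y = scale c (x * y)"
    and translates_independent:
      "\<lbrakk>\<And>f. f \<in> M \<Longrightarrow> (\<Sum>g\<in>carrier G. l g * act g f) = 0; g \<in> carrier G\<rbrakk> \<Longrightarrow> l g = 0"
begin

interpretation reg: group_rep G "pm_scale :: 'k \<Rightarrow> _" "regular_act G" "regular_rep G"
  by (rule group_rep_regular[OF finite_carrier])

text \<open>Independence over \<open>k\<close> persists for scalars in the domain: a
  \<open>k\<close>-linear functional that is nonzero at some \<open>l x\<close> would turn the
  relation into a nontrivial one over \<open>k\<close>.\<close>

lemma independent_scalars_zero: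
  assumes B: "pm.independent B" "finite B" "B \<subseteq> (alg :: ('g \<Rightarrow>\<^sub>0 'k) set)"
    and eq: "\<And>g. g \<in> carrier G \<Longrightarrow> (\<Sum>x\<in>B. scale (Poly_Mapping.lookup x g) (l x)) = 0"
    and "x \<in> B"
  shows "l x = 0"
proof (rule ccontr)
  assume "l x \<noteq> 0"
  then obtain h where h: "Vector_Spaces.linear scale (*) h" "h (l x) \<noteq> 0"
    using linear_functional_nonzero_exists by blast
  interpret h: Vector_Spaces.linear scale "(*)" h by (rule h)
  have "(\<Sum>y\<in>B. pm_scale (h (l y)) y) = 0"
  proof (rule alg_eqI)
    show "(\<Sum>y\<in>B. pm_scale (h (l y)) y) \<in> alg"
      using B(3) by (auto intro!: pm.subspace_sum pm.subspace_scale subspace_regular_rep)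
    show "0 \<in> alg" by (simp add: regular_rep_def)
    fix g assume "g \<in> carrier G"
    then have "h (\<Sum>x\<in>B. scale (Poly_Mapping.lookup x g) (l x)) = 0" using eq by (simp add: h.zero)
    then show "Poly_Mapping.lookup (\<Sum>y\<in>B. pm_scale (h (l y)) y) g = Poly_Mapping.lookup 0 g"
      by (simp add: lookup_sum h.sum h.scale mult.commute)
  qed
  from pm.independentD[OF B(1,2) order_refl this assms(5)] have "h (l x) = 0" .
  then show False using h by simp
qed

text \<open>The functionals on \<open>T\<close> sending \<open>x\<close> to the coefficient of \<open>x \<star> a\<close> at \<open>\<one>\<close>, for \<open>a \<in> R\<close>, miss the
  one given by \<open>a = 1\<close> and so span fewer than \<open>dim T\<close> dimensions. Hence
  there is a nontrivial combination, with coefficients in the domain, of a basis of \<open>T\<close> that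
  annihilates all of \<open>T \<star> R\<close> applied to \<open>f\<close>.\<close>

lemma exists_not_right_mult:
  assumes T: "left_ideal T" and R: "pm.subspace R" "R \<subseteq> alg"
    and no_id: "\<And>a. a \<in> R \<Longrightarrow> \<exists>x\<in>T. x \<star> a \<noteq> x"
    and f: "f \<in> M"
  shows "\<exists>f'\<in>M. \<forall>a\<in>R. \<exists>x\<in>T. alg_act x f' \<noteq> alg_act (x \<star> a) f"
proof (rule ccontr)
  assume "\<not> ?thesis"
  then have all: "\<exists>a\<in>R. \<forall>x\<in>T. alg_act x f' = alg_act (x \<star> a) f" if "f' \<in> M" for f'
    using that by blast
  note TD = left_idealD[OF T]
  obtain B where B: "B \<subseteq> T" "pm.independent B" "T \<subseteq> pm.span B"
    using pm.maximal_independent_subset[of T] by metis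
  have finB: "finite B"
    using pm.independent_span_bound[OF finite_singles B(2)] B(1) TD(1) unfolding alg_span by blast
  have spanB: "pm.span B = T" using B TD(7) pm.span_subspace by blast
  \<comment> \<open>Coordinates, with respect to the basis \<open>B\<close>, of the functional
    attached to \<open>a\<close>. They place these functionals in a space of dimension at most
    \<open>card B\<close>.\<close>
  define r where "r a = (\<Sum>x\<in>B. Poly_Mapping.single x (Poly_Mapping.lookup (x \<star> a) \<one>))" for a
  have lookup_r: "Poly_Mapping.lookup (r a) x = (if x \<in> B then Poly_Mapping.lookup (x \<star> a) \<one> else 0)" for a x
    using finB by (simp add: r_def lookup_sum lookup_single when_def)
  have r_add: "r (a + b) = r a + r b" if "a \<in> alg" "b \<in> alg" for a b
    using that by (intro poly_mapping_eqI) (simp add: lookup_r lookup_add reg.alg_act_add_right)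
  have r_scale: "r (pm_scale c a) = pm_scale c (r a)" if "a \<in> alg" for c a
    using that by (intro poly_mapping_eqI) (simp add: lookup_r reg.alg_act_scale_right)
  have one_alg: "Poly_Mapping.single \<one> 1 \<in> alg" by (simp add: single_in_alg)
  have mult_one: "x \<star> Poly_Mapping.single \<one> 1 = x" if "x \<in> alg" for x
  proof -
    have "x \<star> Poly_Mapping.single \<one> 1 = (\<Sum>g\<in>carrier G. pm_scale (Poly_Mapping.lookup x g) (Poly_Mapping.single g 1))"
      unfolding reg.alg_act_def by (intro sum.cong) (simp_all add: regular_act_def)
    then show ?thesis
      using pm_eq_sum_singles[OF finite_carrier, of x] that by (simp add: regular_rep_def)
  qed
  \<comment> \<open>The functional attached to \<open>a\<close> determines right multiplication by
    \<open>a\<close> on \<open>T\<close>, because \<open>T\<close> contains the translates of its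
    elements.\<close>
  have r_inj: "x \<star> a = x \<star> b" if ab: "a \<in> alg" "b \<in> alg" "r a = r b" and x: "x \<in> T" for a b x
  proof -
    have eq1: "Poly_Mapping.lookup (x \<star> a) \<one> = Poly_Mapping.lookup (x \<star> b) \<one>" if "x \<in> T" for x
    proof -
      have "pm.span B \<subseteq> {x. Poly_Mapping.lookup (x \<star> a) \<one> = Poly_Mapping.lookup (x \<star> b) \<one>}"
      proof (rule pm.span_minimal)
        show "B \<subseteq> {x. Poly_Mapping.lookup (x \<star> a) \<one> = Poly_Mapping.lookup (x \<star> b) \<one>}"
        proof
          fix x assume "x \<in> B"
          then show "x \<in> {x. Poly_Mapping.lookup (x \<star> a) \<one> = Poly_Mapping.lookup (x \<star> b) \<one>}"
            using lookup_r[of a x] lookup_r[of b x] ab(3) by simp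
        qed
        show "pm.subspace {x. Poly_Mapping.lookup (x \<star> a) \<one> = Poly_Mapping.lookup (x \<star> b) \<one>}"
          by (rule pm.subspaceI)
            (auto simp: reg.alg_act_zero_left reg.alg_act_add_left reg.alg_act_scale_left lookup_add)
      qed
      then show ?thesis using that spanB by blast
    qed
    have xA: "x \<in> alg" using x TD(1) by blast
    show ?thesis
    proof (rule alg_eqI)
      show "x \<star> a \<in> alg" "x \<star> b \<in> alg" using ab reg.alg_act_closed by auto
      fix h assume h: "h \<in> carrier G"
      then have "regular_act G (inv h) x \<in> T" using TD(6) x by simp
      then have "Poly_Mapping.lookup (regular_act G (inv h) (x \<star> a)) \<one>
          = Poly_Mapping.lookup (regular_act G (inv h) (x \<star> b)) \<one>"
        using eq1[of "regular_act G (inv h) x"] h ab xA by (simp add: reg.alg_act_regular_act)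
      then show "Poly_Mapping.lookup (x \<star> a) h = Poly_Mapping.lookup (x \<star> b) h"
        using h ab by (simp add: lookup_via_one reg.alg_act_closed)
    qed
  qed
  have sub_rR: "pm.subspace (r ` R)"
  proof (rule pm.subspaceI)
    show "0 \<in> r ` R"
      using pm.subspace_0[OF R(1)] r_scale[of 0 0] R(2) by (metis image_eqI pm.scale_zero_left subsetD)
  next
    fix u v assume "u \<in> r ` R" "v \<in> r ` R"
    then obtain a b where ab: "a \<in> R" "b \<in> R" "u = r a" "v = r b" by blast
    then have "u + v = r (a + b)" using r_add[of a b] subsetD[OF R(2)] by simp
    then show "u + v \<in> r ` R" using pm.subspace_add[OF R(1) ab(1,2)] by simp
  next
    fix c u assume "u \<in> r ` R"
    then obtain a where a: "a \<in> R" "u = r a" by blast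
    then have "pm_scale c u = r (pm_scale c a)" using r_scale[of a c] subsetD[OF R(2)] by simp
    then show "pm_scale c u \<in> r ` R" using pm.subspace_scale[OF R(1) a(1)] by simp
  qed
  have one_not: "r (Poly_Mapping.single \<one> 1) \<notin> r ` R"
  proof
    assume "r (Poly_Mapping.single \<one> 1) \<in> r ` R"
    then obtain a where a: "a \<in> R" "r (Poly_Mapping.single \<one> 1) = r a" by blast
    have "x \<star> a = x" if x: "x \<in> T" for x
      using r_inj[OF subsetD[OF R(2) a(1)] one_alg a(2)[symmetric] x] mult_one[OF subsetD[OF TD(1) x]]
      by simp
    then show False using no_id[OF a(1)] by blast
  qed
  obtain J where J: "J \<subseteq> r ` R" "pm.independent J" "r ` R \<subseteq> pm.span J"
    using pm.maximal_independent_subset[of "r ` R"] by metis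
  have spanJ: "pm.span J = r ` R" using pm.span_subspace[OF J(1,3) sub_rR] .
  let ?S = "(\<lambda>x. Poly_Mapping.single x (1::'k)) ` B"
  have r_keys: "r a \<in> pm.span ?S" for a
    unfolding pm_span_singles[OF finB] by (auto simp: lookup_r in_keys_iff split: if_splits)
  \<comment> \<open>The vector attached to the unit can be added to the basis \<open>J\<close>
    without losing independence, inside a space spanned by at most \<open>card B\<close> vectors.
    Hence \<open>card J < card B\<close>.\<close>
  have "pm.independent (insert (r (Poly_Mapping.single \<one> 1)) J)"
    using J(2) one_not spanJ by (intro pm.independent_insertI) auto
  moreover have "insert (r (Poly_Mapping.single \<one> 1)) J \<subseteq> pm.span ?S"
    using r_keys J(1) by blast
  ultimately have indep_bound: "finite (insert (r (Poly_Mapping.single \<one> 1)) J) \<and>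
      card (insert (r (Poly_Mapping.single \<one> 1)) J) \<le> card ?S"
    by (rule pm.independent_span_bound[OF finite_imageI[OF finB]])
  note bound = conjunct1[OF indep_bound] conjunct2[OF indep_bound]
  have "r (Poly_Mapping.single \<one> 1) \<notin> J" using one_not J(1) by blast
  then have cardJ: "card J < card B"
    using bound card_image_le[OF finB, of "\<lambda>x. Poly_Mapping.single x (1::'k)"] by simp
  have finJ: "finite J" using bound(1) by simp
  define s where "s j = inv_into R r j" for j
  have s: "s j \<in> R" "r (s j) = j" if "j \<in> J" for j
    using J(1) that unfolding s_def by (auto intro: inv_into_into f_inv_into_f)
  \<comment> \<open>One unknown for each element of \<open>B\<close> and one equation for each
    element of \<open>J\<close>, so a nontrivial solution exists.\<close>
  obtain l where l: "\<exists>x\<in>B. l x \<noteq> 0"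
    "\<forall>j\<in>J. (\<Sum>x\<in>B. l x * alg_act (x \<star> s j) f) = 0"
    using homogeneous_system_nontrivial_solution[OF finJ finB cardJ, of "\<lambda>x j. alg_act (x \<star> s j) f"]
    by blast
  define E where "E a = (\<Sum>x\<in>B. l x * alg_act (x \<star> a) f)" for a
  have E_add: "E (a + b) = E a + E b" if "a \<in> alg" "b \<in> alg" for a b
    using that by (simp add: E_def reg.alg_act_add_right alg_act_add_left distrib_left sum.distrib)
  have E_scale: "E (pm_scale c a) = scale c (E a)" if "a \<in> alg" for a c
    using that by (simp add: E_def reg.alg_act_scale_right alg_act_scale_left mult_scale scale_sum_right)
  \<comment> \<open>On \<open>R\<close>, the value \<open>E a\<close> depends only on
    \<open>r a\<close>. It vanishes at the chosen preimages of \<open>J\<close>, hence by linearity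
    on all of \<open>R\<close>.\<close>
  have ER: "E a = 0" if a: "a \<in> R" for a
  proof -
    have "pm.span J \<subseteq> {v. \<exists>a\<in>R. r a = v \<and> E a = 0}"
    proof (rule pm.span_minimal)
      show "J \<subseteq> {v. \<exists>a\<in>R. r a = v \<and> E a = 0}" using s l(2) by (auto simp: E_def)
      show "pm.subspace {v. \<exists>a\<in>R. r a = v \<and> E a = 0}"
      proof (rule pm.subspaceI)
        have "r 0 = 0" "E 0 = 0"
          using r_scale[of 0 0] E_scale[of 0 0] by (simp_all add: regular_rep_def)
        then show "0 \<in> {v. \<exists>a\<in>R. r a = v \<and> E a = 0}" using pm.subspace_0[OF R(1)] by blast
      next
        fix u v assume "u \<in> {v. \<exists>a\<in>R. r a = v \<and> E a = 0}" "v \<in> {v. \<exists>a\<in>R. r a = v \<and> E a = 0}"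
        then obtain a b where "a \<in> R" "b \<in> R" "r a = u" "r b = v" "E a = 0" "E b = 0" by blast
        then show "u + v \<in> {v. \<exists>a\<in>R. r a = v \<and> E a = 0}"
          using R by (auto intro!: bexI[of _ "a + b"] simp: r_add E_add pm.subspace_add subsetD)
      next
        fix c u assume "u \<in> {v. \<exists>a\<in>R. r a = v \<and> E a = 0}"
        then obtain a where "a \<in> R" "r a = u" "E a = 0" by blast
        then show "pm_scale c u \<in> {v. \<exists>a\<in>R. r a = v \<and> E a = 0}"
          using R by (auto intro!: bexI[of _ "pm_scale c a"] simp: r_scale E_scale pm.subspace_scale subsetD)
      qed
    qed
    then obtain b where b: "b \<in> R" "r b = r a" "E b = 0" using a spanJ by blast
    have "E a = E b" unfolding E_def
    proof (intro sum.cong refl)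
      fix x assume "x \<in> B"
      then have "x \<star> a = x \<star> b" using B(1) R(2) a b by (intro r_inj) auto
      then show "l x * alg_act (x \<star> a) f = l x * alg_act (x \<star> b) f" by simp
    qed
    then show ?thesis using b by simp
  qed
  \<comment> \<open>By \<open>all\<close>, the relation carries over from \<open>f\<close> to every
    \<open>f'\<close>. Expanded over the group it becomes a relation between translates, whose
    coefficients must vanish.\<close>
  have "(\<Sum>x\<in>B. scale (Poly_Mapping.lookup x g) (l x)) = 0" if g: "g \<in> carrier G" for g
  proof (rule translates_independent[OF _ g])
    fix f' assume f': "f' \<in> M"
    obtain a where a: "a \<in> R" "\<forall>x\<in>T. alg_act x f' = alg_act (x \<star> a) f" using all[OF f'] by blast
    have "(\<Sum>g\<in>carrier G. (\<Sum>x\<in>B. scale (Poly_Mapping.lookup x g) (l x)) * act g f')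
       = (\<Sum>g\<in>carrier G. \<Sum>x\<in>B. l x * scale (Poly_Mapping.lookup x g) (act g f'))"
      by (simp add: sum_distrib_right mult_scale mult.commute[of "scale _ _"]) (simp add: mult.commute)
    also have "\<dots> = (\<Sum>x\<in>B. l x * alg_act x f')"
      unfolding alg_act_def sum_distrib_left by (rule sum.swap)
    also have "\<dots> = E a" unfolding E_def using a(2) B(1) by (intro sum.cong) auto
    finally show "(\<Sum>g\<in>carrier G. (\<Sum>x\<in>B. scale (Poly_Mapping.lookup x g) (l x)) * act g f') = 0"
      using ER[OF a(1)] by simp
  qed
  then have "l x = 0" if "x \<in> B" for x
    using independent_scalars_zero[OF B(2) finB, of l x] B(1) TD(1) that by blast
  then show False using l(1) by blast
qed

abbreviation socle_annihilator :: "'m \<Rightarrow> ('g \<Rightarrow>\<^sub>0 'k) set" where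
  "socle_annihilator f \<equiv> socle \<inter> {a \<in> alg. alg_act a f = 0}"

text \<open>For a minimal left ideal \<open>T\<close> annihilating \<open>f\<close>, some \<open>f1\<close> has \<open>T f1\<close> independent of
  \<open>socle f\<close>; if \<open>e\<close> projects the socle onto \<open>T\<close>, then \<open>f + e f1\<close> has a smaller annihilator.\<close>

lemma socle_annihilator_decrease:
  assumes f: "f \<in> M" and ne: "socle_annihilator f \<noteq> {0}"
  shows "\<exists>f'\<in>M. socle_annihilator f' \<subset> socle_annihilator f"
proof -
  let ?I = "socle_annihilator f"
  have I: "left_ideal ?I" using left_ideal_inter left_ideal_socle left_ideal_annihilator[OF f] by blast
  obtain T where T: "T \<subseteq> ?I" "minimal_left_ideal T" using minimal_left_ideal_exists[OF I ne] by blast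
  have lT: "left_ideal T" using T(2) by (simp add: minimal_left_ideal_def)
  note TD = left_idealD[OF lT] and SD = left_idealD[OF left_ideal_socle]
  \<comment> \<open>The map \<open>a \<mapsto> a f\<close> is injective on \<open>C\<close>, and its
    image is the submodule \<open>socle f\<close>, called \<open>N\<close> below.\<close>
  obtain C where C: "left_ideal C" "C \<subseteq> socle" "?I \<inter> C = {0}"
    "\<forall>x\<in>socle. \<exists>u\<in>?I. \<exists>c\<in>C. x = u + c"
    using socle_complement_exists[OF I] by blast
  note CD = left_idealD[OF C(1)]
  have C_inj: "c = d" if "c \<in> C" "d \<in> C" "alg_act c f = alg_act d f" for c d
  proof -
    have "c - d \<in> C" using CD(4) that by blast
    moreover have "alg_act (c - d) f = 0" using that(3) by (simp add: alg_act_diff_left)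
    ultimately have "c - d \<in> ?I \<inter> C" using C(2) CD(1) by blast
    then show ?thesis unfolding C(3) by simp
  qed
  define N where "N = (\<lambda>c. alg_act c f) ` C"
  have N_socle: "alg_act x f \<in> N" if "x \<in> socle" for x
  proof -
    obtain u c where "u \<in> ?I" "c \<in> C" "x = u + c" using C(4) \<open>x \<in> socle\<close> by blast
    then show ?thesis by (auto simp: alg_act_add_left N_def)
  qed
  have subN: "kG_submodule G scale act N"
  proof -
    have "0 \<in> N" using CD(2) by (auto simp: N_def image_iff alg_act_zero_left intro!: bexI[of _ 0])
    moreover have "u + v \<in> N" if uv: "u \<in> N" "v \<in> N" for u v
    proof -
      obtain c d where "c \<in> C" "d \<in> C" "u = alg_act c f" "v = alg_act d f"
        using uv by (auto simp: N_def)
      then have "u + v = alg_act (c + d) f" "c + d \<in> C" using CD(3) by (auto simp: alg_act_add_left)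
      then show ?thesis by (simp add: N_def)
    qed
    moreover have "scale k u \<in> N" if u: "u \<in> N" for k u
    proof -
      obtain c where "c \<in> C" "u = alg_act c f" using u by (auto simp: N_def)
      then have "scale k u = alg_act (pm_scale k c) f" "pm_scale k c \<in> C"
        using CD(5) by (auto simp: alg_act_scale_left)
      then show ?thesis by (simp add: N_def)
    qed
    moreover have "act g u \<in> N" if u: "u \<in> N" "g \<in> carrier G" for g u
    proof -
      obtain c where c: "c \<in> C" "u = alg_act c f" using u by (auto simp: N_def)
      then have "c \<in> alg" using CD(1) by blast
      then have "act g u = alg_act (regular_act G g c) f" "regular_act G g c \<in> C"
        using CD(6) c u f by (auto simp: alg_act_regular_act)
      then show ?thesis by (simp add: N_def)
    qed
    ultimately show ?thesis by (auto simp: kG_submodule_def intro!: subspaceI)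
  qed
  \<comment> \<open>These right multiplications give the homomorphisms from \<open>T\<close> to
    \<open>C\<close>, and so to \<open>N\<close>. None of them fixes \<open>T\<close> pointwise, as
    \<open>T\<close> would then lie in \<open>C\<close>, although it lies in \<open>?I\<close>,
    which meets \<open>C\<close> only in \<open>0\<close>.\<close>
  define R where "R = {a \<in> alg. \<forall>x\<in>T. x \<star> a \<in> C}"
  have T_alg: "x \<in> T \<Longrightarrow> x \<in> alg" for x using TD(1) by blast
  have "pm.subspace R"
    using left_idealD(2,3,5)[OF left_ideal_alg] CD(2,3,5) unfolding R_def
    by (intro pm.subspaceI) (auto simp: reg.alg_act_zero_right reg.alg_act_add_right
      reg.alg_act_scale_right pm.subspace_0 pm.subspace_add pm.subspace_scale)
  moreover have "R \<subseteq> alg" by (auto simp: R_def)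
  moreover have "\<exists>x\<in>T. x \<star> a \<noteq> x" if a: "a \<in> R" for a
  proof (rule ccontr)
    assume "\<not> ?thesis"
    then have "T \<subseteq> C" using a by (auto simp: R_def)
    then have "T \<subseteq> ?I \<inter> C" using T(1) by blast
    then have "T \<subseteq> {0}" unfolding C(3) .
    then show False using T(2) TD(2) unfolding minimal_left_ideal_def by blast
  qed
  ultimately obtain f1 where f1: "f1 \<in> M" "\<forall>a\<in>R. \<exists>x\<in>T. alg_act x f1 \<noteq> alg_act (x \<star> a) f"
    using exists_not_right_mult[OF lT _ _ _ f, of R] by blast
  \<comment> \<open>Otherwise \<open>x \<mapsto> x f1\<close>, pulled back from \<open>N\<close> to
    \<open>C\<close>, would be right multiplication by an element of \<open>R\<close>, against the
    choice of \<open>f1\<close>.\<close>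
  have not_sub: "\<exists>x\<in>T. alg_act x f1 \<notin> N"
  proof (rule ccontr)
    assume "\<not> ?thesis"
    then have "\<forall>x\<in>T. \<exists>c. c \<in> C \<and> alg_act c f = alg_act x f1" by (force simp: N_def)
    then obtain p where p: "\<And>x. x \<in> T \<Longrightarrow> p x \<in> C" "\<And>x. x \<in> T \<Longrightarrow> alg_act (p x) f = alg_act x f1"
      by metis
    have p_alg: "x \<in> T \<Longrightarrow> p x \<in> alg" for x using p(1) CD(1) by blast
    have "\<exists>a\<in>alg. \<forall>x\<in>T. x \<star> a = p x"
    proof (rule module_hom_is_right_mult[OF lT p_alg])
      fix x assume x: "x \<in> T"
      show "p (x + y) = p x + p y" if "y \<in> T" for y
        using x that p CD(3) TD(3) by (intro C_inj) (auto simp: alg_act_add_left)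
      show "p (pm_scale c x) = pm_scale c (p x)" for c
        using x p CD(5) TD(5) by (intro C_inj) (auto simp: alg_act_scale_left)
      show "p (regular_act G g x) = regular_act G g (p x)" if "g \<in> carrier G" for g
        using x that p p_alg T_alg CD(6) TD(6) f f1(1) by (intro C_inj) (auto simp: alg_act_regular_act)
    qed
    then obtain a where a: "a \<in> alg" "\<forall>x\<in>T. x \<star> a = p x" by blast
    then have "a \<in> R" using p(1) by (auto simp: R_def)
    then show False using f1(2) a(2) p(2) by force
  qed
  \<comment> \<open>The elements of \<open>T\<close> sending \<open>f1\<close> into \<open>N\<close>
    form a left ideal properly inside \<open>T\<close>, so minimality makes it zero.\<close>
  have int: "x = 0" if x: "x \<in> T" "alg_act x f1 \<in> N" for x
  proof -
    have "left_ideal {x \<in> T. alg_act x f1 \<in> N}"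
      using TD T_alg subN f1(1)
      by (intro left_idealI) (auto simp: kG_submodule_def alg_act_zero_left alg_act_add_left
        alg_act_scale_left alg_act_regular_act subspace_0 subspace_add subspace_scale)
    then have "{x \<in> T. alg_act x f1 \<in> N} = {0} \<or> {x \<in> T. alg_act x f1 \<in> N} = T"
      by (rule minimal_left_idealD[OF T(2)]) blast
    then show ?thesis using not_sub x by blast
  qed
  have "T \<subseteq> socle" using minimal_left_ideal_subset_socle[OF T(2)] .
  then obtain e where e: "e \<in> alg" "\<forall>x\<in>socle. x \<star> e \<in> T" "\<forall>x\<in>T. x \<star> e = x"
    using socle_projection_exists[OF lT] by blast
  define f' where "f' = f + alg_act e f1"
  have f': "f' \<in> M" unfolding f'_def using f f1(1) by (intro subspace_add subspace_M alg_act_closed)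
  have act_f': "alg_act x f' = alg_act x f + alg_act (x \<star> e) f1" for x
    using f f1(1) e(1) by (simp add: f'_def alg_act_add_right alg_act_closed alg_act_alg_mult)
  \<comment> \<open>If \<open>x f + (x e) f1 = 0\<close>, then \<open>(x e) f1\<close> lies in
    \<open>N\<close> while \<open>x e\<close> lies in \<open>T\<close>. Hence
    \<open>x e = 0\<close>, and then \<open>x f = 0\<close>.\<close>
  have key: "alg_act x f = 0 \<and> x \<star> e = 0" if x: "x \<in> socle" "alg_act x f' = 0" for x
  proof -
    have "alg_act (x \<star> e) f1 = alg_act (- x) f"
      using x(2) act_f' by (simp add: alg_act_uminus_left add_eq_0_iff)
    moreover have "- x \<in> socle" using pm.subspace_neg[OF SD(7)] x(1) by blast
    ultimately have "x \<star> e = 0" using int e(2) x(1) N_socle by simp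
    then show ?thesis using x(2) act_f' by (simp add: alg_act_zero_left)
  qed
  have sub: "socle_annihilator f' \<subseteq> ?I" using key by blast
  \<comment> \<open>The inclusion is strict because \<open>e\<close> fixes every element of
    \<open>T\<close>, whereas \<open>T\<close> annihilates \<open>f\<close>.\<close>
  obtain x where x: "x \<in> T" "x \<noteq> 0"
    using T(2) TD(2) unfolding minimal_left_ideal_def by blast
  have "x \<in> ?I" using x T(1) by blast
  moreover have "x \<notin> socle_annihilator f'" using key[of x] e(3) x by auto
  ultimately show ?thesis using sub f' by blast
qed

text \<open>Choose \<open>f\<close> with minimal socle annihilator, which is then zero by the
  preceding lemma. A nonzero annihilator in \<open>kG\<close> would contain a minimal left ideal,
  and this lies in the socle.\<close>

theorem exists_free_vector: "\<exists>f\<in>M. \<forall>a\<in>alg. alg_act a f = 0 \<longrightarrow> a = 0"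
proof -
  obtain U where U: "\<exists>f\<in>M. U = socle_annihilator f"
    "\<forall>W. (\<exists>f\<in>M. W = socle_annihilator f) \<longrightarrow> W \<subseteq> U \<longrightarrow> W = U"
  proof (atomize_elim, rule pm.subspace_minimal_exists[OF finite_singles])
    fix U assume "\<exists>f\<in>M. U = socle_annihilator f"
    then obtain f where f: "f \<in> M" "U = socle_annihilator f" by blast
    then have "left_ideal U"
      using left_ideal_inter[OF left_ideal_socle left_ideal_annihilator] by simp
    then show "pm.subspace U \<and> U \<subseteq> pm.span ((\<lambda>g. Poly_Mapping.single g 1) ` carrier G)"
      using left_idealD(1,7) unfolding alg_span by blast
  next
    show "\<exists>f\<in>M. socle_annihilator 0 = socle_annihilator f"
      using subspace_0[OF subspace_M] by blast
  qed
  then obtain f where f: "f \<in> M" "U = socle_annihilator f" by blast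
  have Uz: "U = {0}" using socle_annihilator_decrease[OF f(1)] U(2) f(2) by blast
  let ?A = "{a \<in> alg. alg_act a f = 0}"
  have A: "left_ideal ?A" by (rule left_ideal_annihilator[OF f(1)])
  have "?A = {0}"
  proof (rule ccontr)
    assume "?A \<noteq> {0}"
    then obtain T where T: "T \<subseteq> ?A" "minimal_left_ideal T" using minimal_left_ideal_exists[OF A] by blast
    have "T \<subseteq> U" using T minimal_left_ideal_subset_socle[OF T(2)] unfolding f(2) by blast
    then have "T = {0}" using Uz T(2) left_idealD(2)[of T] unfolding minimal_left_ideal_def by blast
    then show False using T(2) by (simp add: minimal_left_ideal_def)
  qed
  then show ?thesis using f(1) by blast
qed

end

section \<open>Substitution of polynomials\<close>

definition mon_degree :: "(nat \<Rightarrow>\<^sub>0 nat) \<Rightarrow> nat" where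
  "mon_degree m = (\<Sum>i\<in>Poly_Mapping.keys m. Poly_Mapping.lookup m i)"

definition mon_subst :: "(nat \<Rightarrow> 'k::field polynomials) \<Rightarrow> (nat \<Rightarrow>\<^sub>0 nat) \<Rightarrow> 'k polynomials" where
  "mon_subst s m = (\<Prod>i\<in>Poly_Mapping.keys m. s i ^ Poly_Mapping.lookup m i)"

lemma keys_add_nat:
  fixes m m' :: "nat \<Rightarrow>\<^sub>0 nat"
  shows "Poly_Mapping.keys (m + m') = Poly_Mapping.keys m \<union> Poly_Mapping.keys m'"
  by (auto simp: in_keys_iff lookup_add)

lemma mon_degree_superset:
  assumes "finite A" "Poly_Mapping.keys m \<subseteq> A"
  shows "mon_degree m = (\<Sum>i\<in>A. Poly_Mapping.lookup m i)"
  unfolding mon_degree_def using assms by (intro sum.mono_neutral_left) (auto simp: in_keys_iff)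

lemma mon_degree_add: "mon_degree (m + m') = mon_degree m + mon_degree m'"
proof -
  let ?A = "Poly_Mapping.keys m \<union> Poly_Mapping.keys m'"
  have "mon_degree (m + m') = (\<Sum>i\<in>?A. Poly_Mapping.lookup m i + Poly_Mapping.lookup m' i)"
    by (subst mon_degree_superset[of ?A]) (auto simp: keys_add_nat lookup_add)
  then show ?thesis
    by (simp add: sum.distrib mon_degree_superset[of ?A m] mon_degree_superset[of ?A m'])
qed

lemma mon_subst_superset:
  assumes "finite A" "Poly_Mapping.keys m \<subseteq> A"
  shows "mon_subst s m = (\<Prod>i\<in>A. s i ^ Poly_Mapping.lookup m i)"
  unfolding mon_subst_def using assms by (intro prod.mono_neutral_left) (auto simp: in_keys_iff)

lemma mon_subst_add: "mon_subst s (m + m') = mon_subst s m * mon_subst s m'"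
proof -
  let ?A = "Poly_Mapping.keys m \<union> Poly_Mapping.keys m'"
  have "mon_subst s (m + m') = (\<Prod>i\<in>?A. s i ^ Poly_Mapping.lookup m i * s i ^ Poly_Mapping.lookup m' i)"
    by (subst mon_subst_superset[of ?A]) (auto simp: keys_add_nat lookup_add power_add)
  then show ?thesis
    by (simp add: prod.distrib mon_subst_superset[of ?A m] mon_subst_superset[of ?A m'])
qed

lemma pm_scale_conv_mult:
  fixes p :: "'b::comm_monoid_add \<Rightarrow>\<^sub>0 'k::field"
  shows "pm_scale c p = Poly_Mapping.single 0 c * p"
  by (simp add: pm_scale_def mult_map_scale_conv_mult)

lemma pm_scale_mult_left:
  fixes p q :: "'k::field polynomials"
  shows "pm_scale c p * q = pm_scale c (p * q)"
  by (simp add: pm_scale_conv_mult mult.assoc)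

lemma pm_scale_mult_right:
  fixes p q :: "'k::field polynomials"
  shows "p * pm_scale c q = pm_scale c (p * q)"
  by (simp add: pm_scale_conv_mult mult_ac)

lemma pm_scale_single: "pm_scale c (Poly_Mapping.single m d) = Poly_Mapping.single m (c * d)"
  by (rule poly_mapping_eqI) (simp add: lookup_single when_def)

lemma poly_subst_superset:
  assumes "finite A" "Poly_Mapping.keys p \<subseteq> A"
  shows "poly_subst s p = (\<Sum>m\<in>A. pm_scale (Poly_Mapping.lookup p m) (mon_subst s m))"
  unfolding poly_subst_def mon_subst_def[symmetric] using assms
  by (intro sum.mono_neutral_left) (auto simp: in_keys_iff)

lemma poly_subst_zero [simp]: "poly_subst s 0 = 0"
  by (simp add: poly_subst_def)

lemma poly_subst_add: "poly_subst s (p + q) = poly_subst s p + poly_subst s q"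
proof -
  let ?A = "Poly_Mapping.keys p \<union> Poly_Mapping.keys q"
  have "poly_subst s (p + q)
      = (\<Sum>m\<in>?A. pm_scale (Poly_Mapping.lookup (p + q) m) (mon_subst s m))"
    by (rule poly_subst_superset) (use keys_add[of p q] in auto)
  then show ?thesis
    by (simp add: lookup_add pm.scale_left_distrib sum.distrib
      poly_subst_superset[of ?A p] poly_subst_superset[of ?A q])
qed

lemma poly_subst_scale: "poly_subst s (pm_scale c p) = pm_scale c (poly_subst s p)"
proof -
  have "Poly_Mapping.keys (pm_scale c p) \<subseteq> Poly_Mapping.keys p" by (auto simp: in_keys_iff)
  then show ?thesis
    by (subst (1 2) poly_subst_superset[of "Poly_Mapping.keys p"])
      (auto simp: pm.scale_sum_right)
qed

lemma poly_subst_sum: "poly_subst s (sum f I) = (\<Sum>i\<in>I. poly_subst s (f i))"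
  by (induction I rule: infinite_finite_induct) (auto simp: poly_subst_add)

lemma poly_subst_single: "poly_subst s (Poly_Mapping.single m c) = pm_scale c (mon_subst s m)"
  by (subst poly_subst_superset[of "{m}"]) auto

lemma polynomial_expand:
  "p = (\<Sum>m\<in>Poly_Mapping.keys p. Poly_Mapping.single m (Poly_Mapping.lookup p m))"
  for p :: "'k::field polynomials"
  using pm_eq_sum_singles[OF finite_keys order_refl, of p] by (simp add: pm_scale_single)

lemma poly_subst_mult: "poly_subst s (p * q) = poly_subst s p * poly_subst s q"
proof -
  have "p * q = (\<Sum>m\<in>Poly_Mapping.keys p. \<Sum>m'\<in>Poly_Mapping.keys q.
      Poly_Mapping.single (m + m') (Poly_Mapping.lookup p m * Poly_Mapping.lookup q m'))"
    unfolding mult_single[symmetric] sum_product[symmetric]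
    by (simp only: polynomial_expand[symmetric])
  then have "poly_subst s (p * q) = (\<Sum>m\<in>Poly_Mapping.keys p. \<Sum>m'\<in>Poly_Mapping.keys q.
      pm_scale (Poly_Mapping.lookup p m) (mon_subst s m) * pm_scale (Poly_Mapping.lookup q m') (mon_subst s m'))"
    by (simp add: poly_subst_sum poly_subst_single mon_subst_add pm_scale_mult_left pm_scale_mult_right mult_ac)
  then show ?thesis
    by (simp add: sum_product poly_subst_superset[OF finite_keys order_refl, of s p]
      poly_subst_superset[OF finite_keys order_refl, of s q])
qed

lemma poly_subst_one [simp]: "poly_subst s 1 = 1"
proof -
  have "poly_subst s (Poly_Mapping.single 0 1) = pm_scale 1 (mon_subst s 0)"
    by (rule poly_subst_single)
  also have "\<dots> = 1" by (simp add: mon_subst_def)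
  finally have "poly_subst s (Poly_Mapping.single 0 1) = 1" .
  then show ?thesis by simp
qed

lemma poly_subst_power: "poly_subst s (p ^ e) = poly_subst s p ^ e"
  by (induction e) (auto simp: poly_subst_mult)

lemma poly_subst_prod: "poly_subst s (prod f I) = (\<Prod>i\<in>I. poly_subst s (f i))"
  by (induction I rule: infinite_finite_induct) (auto simp: poly_subst_mult)

lemma poly_subst_var [simp]: "poly_subst s (poly_var i) = s i"
  by (simp add: poly_var_def poly_subst_single mon_subst_def pm_scale_conv_mult)

lemma poly_subst_subst: "poly_subst t (poly_subst s p) = poly_subst (\<lambda>i. poly_subst t (s i)) p"
  unfolding poly_subst_def[of s p] poly_subst_def[of "\<lambda>i. poly_subst t (s i)" p]
  by (simp add: poly_subst_sum poly_subst_scale poly_subst_prod poly_subst_power)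

lemma mon_subst_var: "mon_subst poly_var m = Poly_Mapping.single m (1::'k::field)"
proof -
  have pow: "poly_var i ^ e = Poly_Mapping.single (Poly_Mapping.single i e) (1::'k)" for i e
    by (induction e) (auto simp: poly_var_def mult_single single_add[symmetric])
  have "(\<Prod>i\<in>A. poly_var i ^ f i) = Poly_Mapping.single (\<Sum>i\<in>A. Poly_Mapping.single i (f i)) (1::'k)"
    if "finite A" for A f
    using that by (induction A) (auto simp: pow mult_single)
  then have "mon_subst poly_var m =
      Poly_Mapping.single (\<Sum>i\<in>Poly_Mapping.keys m. Poly_Mapping.single i (Poly_Mapping.lookup m i)) (1::'k)"
    by (simp add: mon_subst_def)
  moreover have "(\<Sum>i\<in>Poly_Mapping.keys m. Poly_Mapping.single i (Poly_Mapping.lookup m i)) = m"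
    by (rule poly_mapping_eqI) (auto simp: lookup_sum lookup_single when_def in_keys_iff)
  ultimately show ?thesis by simp
qed

lemma poly_subst_id: "poly_subst poly_var p = p"
  using polynomial_expand[of p]
  by (simp add: poly_subst_superset[OF finite_keys order_refl, of _ p] mon_subst_var pm_scale_single)

lemma poly_subst_cong:
  assumes "p \<in> poly_ring n" "\<And>i. i < n \<Longrightarrow> s i = t i"
  shows "poly_subst s p = poly_subst t p"
  unfolding poly_subst_def using assms
  by (intro sum.cong refl arg_cong2[where f = pm_scale] prod.cong) (auto simp: poly_ring_def subset_eq)

section \<open>Polynomials in \<open>n\<close> variables and their degrees\<close>

lemma poly_ring_le_alt:
  "poly_ring_le n d = {p \<in> poly_ring n. \<forall>m\<in>Poly_Mapping.keys p. mon_degree m \<le> d}"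
  by (simp add: poly_ring_le_def mon_degree_def)

lemma poly_ring_le_subset: "poly_ring_le n d \<subseteq> poly_ring n"
  by (auto simp: poly_ring_le_def)

lemma poly_ring_le_mono: "d \<le> e \<Longrightarrow> poly_ring_le n d \<subseteq> poly_ring_le n e"
  by (auto simp: poly_ring_le_def)

lemma keys_pm_scale_subset: "Poly_Mapping.keys (pm_scale c p) \<subseteq> Poly_Mapping.keys p"
  by (auto simp: in_keys_iff)

lemma subspace_poly_ring: "pm.subspace (poly_ring n :: 'k::field polynomials set)"
proof (rule pm.subspaceI)
  fix x y :: "'k polynomials" and c :: 'k assume x: "x \<in> poly_ring n"
  show "x + y \<in> poly_ring n" if y: "y \<in> poly_ring n"
    using x y keys_add[of x y] unfolding poly_ring_def by blast
  show "pm_scale c x \<in> poly_ring n"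
    using x keys_pm_scale_subset[of c x] unfolding poly_ring_def by blast
qed (simp add: poly_ring_def)

lemma subspace_poly_ring_le: "pm.subspace (poly_ring_le n d :: 'k::field polynomials set)"
proof (rule pm.subspaceI)
  note sub = subspace_poly_ring[of n, where 'k = 'k]
  show "(0 :: 'k polynomials) \<in> poly_ring_le n d" using pm.subspace_0[OF sub] by (simp add: poly_ring_le_alt)
  fix x y :: "'k polynomials" and c :: 'k assume x: "x \<in> poly_ring_le n d"
  show "x + y \<in> poly_ring_le n d" if y: "y \<in> poly_ring_le n d"
    using x y keys_add[of x y] pm.subspace_add[OF sub, of x y] unfolding poly_ring_le_alt by blast
  show "pm_scale c x \<in> poly_ring_le n d"
    using x keys_pm_scale_subset[of c x] pm.subspace_scale[OF sub, of x c] unfolding poly_ring_le_alt by blast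
qed

lemma poly_ring_mult:
  assumes "p \<in> poly_ring n" "q \<in> poly_ring n" shows "p * q \<in> poly_ring n"
  unfolding poly_ring_def
proof safe
  fix m i assume "m \<in> Poly_Mapping.keys (p * q)" and i: "i \<in> Poly_Mapping.keys m"
  then obtain a c where "m = a + c" "a \<in> Poly_Mapping.keys p" "c \<in> Poly_Mapping.keys q"
    using keys_mult[of p q] by blast
  then show "i < n" using assms i by (auto simp: poly_ring_def keys_add_nat)
qed

lemma poly_ring_one [simp]: "1 \<in> poly_ring n"
  by (simp add: poly_ring_def)

lemma poly_ring_prod: "(\<And>i. i \<in> I \<Longrightarrow> f i \<in> poly_ring n) \<Longrightarrow> prod f I \<in> poly_ring n"
  by (induction I rule: infinite_finite_induct) (auto intro: poly_ring_mult)

lemma poly_ring_le_mult: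
  assumes "p \<in> poly_ring_le n d" "q \<in> poly_ring_le n e" shows "p * q \<in> poly_ring_le n (d + e)"
  unfolding poly_ring_le_alt
proof safe
  show "p * q \<in> poly_ring n" using assms poly_ring_mult poly_ring_le_subset by blast
  fix m assume "m \<in> Poly_Mapping.keys (p * q)"
  then obtain a c where "m = a + c" "a \<in> Poly_Mapping.keys p" "c \<in> Poly_Mapping.keys q"
    using keys_mult[of p q] by blast
  then show "mon_degree m \<le> d + e" using assms by (auto simp: poly_ring_le_alt mon_degree_add intro: add_mono)
qed

lemma poly_ring_le_one [simp]: "1 \<in> poly_ring_le n 0"
  by (simp add: poly_ring_le_def)

lemma poly_ring_le_prod:
  "finite I \<Longrightarrow> (\<And>i. i \<in> I \<Longrightarrow> f i \<in> poly_ring_le n (d i)) \<Longrightarrow> prod f I \<in> poly_ring_le n (sum d I)"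
  by (induction I rule: finite_induct) (auto intro: poly_ring_le_mult)

lemma poly_ring_le_power: "p \<in> poly_ring_le n d \<Longrightarrow> p ^ e \<in> poly_ring_le n (e * d)"
  by (induction e) (auto intro: poly_ring_le_mult)

lemma poly_var_in: "i < n \<Longrightarrow> poly_var i \<in> poly_ring_le n 1"
  by (simp add: poly_var_def poly_ring_le_def poly_ring_def)

text \<open>Variables are replaced by polynomials of degree at most 1, so no monomial gains degree.
  This is why \<open>poly_ring_le n d\<close> is stable under the group.\<close>

lemma poly_subst_closed_le:
  assumes "p \<in> poly_ring_le n d" "\<And>i. i < n \<Longrightarrow> s i \<in> poly_ring_le n 1"
  shows "poly_subst s p \<in> poly_ring_le n d"
  unfolding poly_subst_def
proof (intro pm.subspace_sum[OF subspace_poly_ring_le] pm.subspace_scale[OF subspace_poly_ring_le])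
  fix m assume m: "m \<in> Poly_Mapping.keys p"
  have "(\<Prod>i\<in>Poly_Mapping.keys m. s i ^ Poly_Mapping.lookup m i)
      \<in> poly_ring_le n (\<Sum>i\<in>Poly_Mapping.keys m. Poly_Mapping.lookup m i * 1)"
    using assms m by (intro poly_ring_le_prod poly_ring_le_power) (auto simp: poly_ring_le_def poly_ring_def)
  moreover have "(\<Sum>i\<in>Poly_Mapping.keys m. Poly_Mapping.lookup m i * 1) \<le> d"
    using assms(1) m by (auto simp: poly_ring_le_def)
  ultimately show "(\<Prod>i\<in>Poly_Mapping.keys m. s i ^ Poly_Mapping.lookup m i) \<in> poly_ring_le n d"
    using poly_ring_le_mono by blast
qed

lemma poly_ring_bounded: "p \<in> poly_ring n \<Longrightarrow> \<exists>d. p \<in> poly_ring_le n d"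
  \<comment> \<open>For the zero polynomial there is no monomial to bound, so the unspecified
    maximum of the empty set does no harm.\<close>
  by (intro exI[of _ "Max (mon_degree ` Poly_Mapping.keys p)"]) (auto simp: poly_ring_le_alt)

lemma poly_subst_closed:
  assumes "p \<in> poly_ring n" "\<And>i. i < n \<Longrightarrow> s i \<in> poly_ring_le n 1"
  shows "poly_subst s p \<in> poly_ring n"
proof -
  obtain d where "p \<in> poly_ring_le n d" using poly_ring_bounded[OF assms(1)] by blast
  then have "poly_subst s p \<in> poly_ring_le n d" using assms(2) by (rule poly_subst_closed_le)
  then show ?thesis using poly_ring_le_subset by blast
qed

text \<open>Stars and bars: appending the slack \<open>d - mon_degree m\<close> to the exponents
  gives a list of length \<open>n + 1\<close> with sum exactly \<open>d\<close>. An injective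
  encoding suffices for the upper bound.\<close>

lemma finite_card_monomials:
  defines "Mon n d \<equiv> {m. Poly_Mapping.keys m \<subseteq> {..<n} \<and> mon_degree m \<le> d}"
  shows "finite (Mon n d)" "card (Mon n d) \<le> (d + n) choose n"
proof -
  let ?L = "{l::nat list. length l = Suc n \<and> sum_list l = d}"
  define enc where "enc m = map (Poly_Mapping.lookup m) [0..<n] @ [d - mon_degree m]" for m
  have "inj_on enc (Mon n d)"
  proof (rule inj_onI)
    fix m m' assume m: "m \<in> Mon n d" "m' \<in> Mon n d" "enc m = enc m'"
    then have "\<forall>i<n. Poly_Mapping.lookup m i = Poly_Mapping.lookup m' i"
      by (simp add: enc_def)
    moreover have "\<forall>i. \<not> i < n \<longrightarrow> Poly_Mapping.lookup m i = 0 \<and> Poly_Mapping.lookup m' i = 0"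
      using m(1,2) by (auto simp: Mon_def in_keys_iff subset_eq)
    ultimately show "m = m'" by (intro poly_mapping_eqI) metis
  qed
  moreover have "enc ` Mon n d \<subseteq> ?L"
  proof safe
    fix m assume m: "m \<in> Mon n d"
    have "mon_degree m = (\<Sum>i\<leftarrow>[0..<n]. Poly_Mapping.lookup m i)"
      using m mon_degree_superset[of "{..<n}" m]
      by (simp add: Mon_def interv_sum_list_conv_sum_set_nat lessThan_atLeast0)
    then show "sum_list (enc m) = d" using m by (simp add: enc_def Mon_def)
    show "length (enc m) = Suc n" by (simp add: enc_def)
  qed
  moreover have cL: "card ?L = (d + n) choose n"
    using card_length_sum_list[of "Suc n" d] binomial_symmetric[of d "d + n"] by simp
  \<comment> \<open>An infinite set has cardinality \<open>0\<close>, while this binomial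
    coefficient is positive.\<close>
  moreover have "finite ?L" using cL by (intro card_ge_0_finite) simp
  ultimately show "finite (Mon n d)" "card (Mon n d) \<le> (d + n) choose n"
    using inj_on_finite[of enc "Mon n d" ?L] card_inj_on_le[of enc "Mon n d" ?L] by simp_all
qed

lemma poly_ring_le_span:
  "poly_ring_le n d = pm.span ((\<lambda>m. Poly_Mapping.single m (1::'k::field)) `
     {m. Poly_Mapping.keys m \<subseteq> {..<n} \<and> mon_degree m \<le> d})"
  unfolding pm_span_singles[OF finite_card_monomials(1)]
  by (auto simp: poly_ring_le_alt poly_ring_def)

section \<open>The action on polynomials and rational functions\<close>

locale polynomial_action =
  group G + V: finite_dimensional_vector_space scale "b ` {..<n}"
    + faithful_action G "UNIV :: 'v set" \<rho>
  for G :: "('g, 'm) monoid_scheme" (structure)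
    and scale :: "'k::field \<Rightarrow> 'v::ab_group_add \<Rightarrow> 'v"
    and b :: "nat \<Rightarrow> 'v" and n :: nat
    and \<rho> :: "'g \<Rightarrow> 'v \<Rightarrow> 'v" +
  assumes finite_carrier: "finite (carrier G)"
    and inj_b: "inj_on b {..<n}"
    and linear_\<rho>: "g \<in> carrier G \<Longrightarrow> Vector_Spaces.linear scale scale (\<rho> g)"
begin

abbreviation pact :: "'g \<Rightarrow> 'k polynomials \<Rightarrow> 'k polynomials" where
  "pact \<equiv> poly_act G scale b n \<rho>"

abbreviation cd :: "'v \<Rightarrow> nat \<Rightarrow> 'k" where "cd \<equiv> coord scale b n"

text \<open>This is the linear form \<open>g x\<^sub>i\<close>; its coefficients are row
  \<open>i\<close> of the matrix of \<open>inv g\<close>.\<close>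

definition lform :: "'g \<Rightarrow> nat \<Rightarrow> 'k polynomials" where
  "lform g i = (\<Sum>j<n. pm_scale (cd (\<rho> (inv g) (b j)) i) (poly_var j))"

lemma pact_eq: "pact g = poly_subst (lform g)"
  unfolding poly_act_def lform_def by simp

lemma coord_add: "cd (v + w) i = cd v i + cd w i"
  unfolding coord_def by (simp add: V.representation_add V.independent_Basis V.span_Basis)

lemma coord_scale: "cd (scale c v) i = c * cd v i"
  unfolding coord_def by (simp add: V.representation_scale V.independent_Basis V.span_Basis)

lemma coord_zero: "cd 0 i = 0"
  using coord_scale[of 0 0 i] by simp

lemma coord_sum: "cd (sum f I) i = (\<Sum>x\<in>I. cd (f x) i)"
  by (induction I rule: infinite_finite_induct) (auto simp: coord_zero coord_add)

lemma coord_basis: "i < n \<Longrightarrow> j < n \<Longrightarrow> cd (b j) i = (if i = j then 1 else 0)"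
  unfolding coord_def using inj_b
  by (auto simp: V.representation_basis V.independent_Basis dest: inj_onD)

lemma coord_expand: "v = (\<Sum>j<n. scale (cd v j) (b j))"
proof -
  have "(\<Sum>x\<in>b ` {..<n}. scale (V.representation (b ` {..<n}) v x) x) = v"
    by (rule V.sum_representation_eq[OF V.independent_Basis]) (auto simp: V.span_Basis)
  then show ?thesis
    using inj_b by (simp add: sum.reindex coord_def)
qed

lemma coord_\<rho>:
  assumes "g \<in> carrier G"
  shows "cd (\<rho> g v) i = (\<Sum>j<n. cd v j * cd (\<rho> g (b j)) i)"
proof -
  interpret L: Vector_Spaces.linear scale scale "\<rho> g" by (rule linear_\<rho>[OF assms])
  have "\<rho> g v = (\<Sum>j<n. scale (cd v j) (\<rho> g (b j)))"
    by (subst coord_expand[of v]) (simp add: L.sum L.scale)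
  then show ?thesis by (simp add: coord_sum coord_scale)
qed

lemma lform_in: "lform g i \<in> poly_ring_le n 1"
  unfolding lform_def
  by (intro pm.subspace_sum[OF subspace_poly_ring_le] pm.subspace_scale[OF subspace_poly_ring_le] poly_var_in)
    auto

lemma lookup_lform:
  assumes "j < n"
  shows "Poly_Mapping.lookup (lform g i) (Poly_Mapping.single j 1) = cd (\<rho> (inv g) (b j)) i"
proof -
  have "Poly_Mapping.single l (1::nat) = Poly_Mapping.single j 1 \<longleftrightarrow> l = j" for l
    by (metis keys_single one_neq_zero singleton_inject)
  then have "Poly_Mapping.lookup (lform g i) (Poly_Mapping.single j 1) =
      (\<Sum>l<n. if l = j then cd (\<rho> (inv g) (b j)) i else 0)"
    unfolding lform_def lookup_sum
    by (intro sum.cong) (auto simp: poly_var_def lookup_single when_def)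
  then show ?thesis using assms by simp
qed

text \<open>Inversion and substitution both reverse the order of composition, so the two reversals
  cancel and leave a left action.\<close>

lemma pact_lform:
  assumes "g \<in> carrier G" "h \<in> carrier G"
  shows "pact g (lform h i) = lform (g \<otimes> h) i"
proof -
  have "pact g (lform h i) = (\<Sum>j<n. pm_scale (cd (\<rho> (inv h) (b j)) i) (lform g j))"
    unfolding pact_eq lform_def[of h i] by (simp add: poly_subst_sum poly_subst_scale)
  also have "\<dots> = (\<Sum>j<n. \<Sum>l<n. pm_scale (cd (\<rho> (inv h) (b j)) i * cd (\<rho> (inv g) (b l)) j) (poly_var l))"
    unfolding lform_def by (simp add: pm.scale_sum_right)
  also have "\<dots> = (\<Sum>l<n. \<Sum>j<n. pm_scale (cd (\<rho> (inv h) (b j)) i * cd (\<rho> (inv g) (b l)) j) (poly_var l))"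
    by (rule sum.swap)
  also have "\<dots> = (\<Sum>l<n. pm_scale (cd (\<rho> (inv h) (\<rho> (inv g) (b l))) i) (poly_var l))"
    using assms by (simp add: pm.scale_sum_left[symmetric] coord_\<rho>[of "inv h" "\<rho> _ _"] mult.commute)
  also have "\<dots> = lform (g \<otimes> h) i"
    unfolding lform_def using assms
    by (simp add: inv_mult_group composition_rule)
  finally show ?thesis .
qed

lemma lform_one: "i < n \<Longrightarrow> lform \<one> i = poly_var i"
proof -
  assume i: "i < n"
  have "\<rho> \<one> v = v" for v using id_eq_one by (metis UNIV_I restrict_apply')
  then have "lform \<one> i = (\<Sum>j<n. if j = i then poly_var j else 0)"
    unfolding lform_def using i by (intro sum.cong) (auto simp: coord_basis)
  then show ?thesis using i by simp
qed

lemma pact_closed: "p \<in> poly_ring n \<Longrightarrow> pact g p \<in> poly_ring n"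
  unfolding pact_eq by (rule poly_subst_closed[OF _ lform_in])

lemma pact_closed_le: "p \<in> poly_ring_le n d \<Longrightarrow> pact g p \<in> poly_ring_le n d"
  unfolding pact_eq by (rule poly_subst_closed_le[OF _ lform_in])

lemma pact_add: "pact g (p + q) = pact g p + pact g q"
  by (simp add: pact_eq poly_subst_add)

lemma pact_scale: "pact g (pm_scale c p) = pm_scale c (pact g p)"
  by (simp add: pact_eq poly_subst_scale)

lemma pact_mult: "pact g (p * q) = pact g p * pact g q"
  by (simp add: pact_eq poly_subst_mult)

lemma pact_prod: "pact g (prod f I) = (\<Prod>i\<in>I. pact g (f i))"
  by (simp add: pact_eq poly_subst_prod)

lemma pact_sum: "pact g (sum f I) = (\<Sum>i\<in>I. pact g (f i))"
  by (simp add: pact_eq poly_subst_sum)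

lemma pact_0 [simp]: "pact g 0 = 0" and pact_1 [simp]: "pact g 1 = 1"
  by (simp_all add: pact_eq)

lemma pact_pact:
  assumes "g \<in> carrier G" "h \<in> carrier G"
  shows "pact g (pact h p) = pact (g \<otimes> h) p"
  using pact_lform[OF assms] by (simp add: pact_eq poly_subst_subst)

lemma pact_one: "p \<in> poly_ring n \<Longrightarrow> pact \<one> p = p"
  unfolding pact_eq using poly_subst_cong[of p n "lform \<one>" poly_var] lform_one by (simp add: poly_subst_id)

lemma pact_inv: "g \<in> carrier G \<Longrightarrow> p \<in> poly_ring n \<Longrightarrow> pact g (pact (inv g) p) = p"
  by (simp add: pact_pact pact_one)

lemma pact_eq_0: "g \<in> carrier G \<Longrightarrow> p \<in> poly_ring n \<Longrightarrow> pact g p = 0 \<longleftrightarrow> p = 0"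
  using pact_inv[of "inv g" p] by auto

text \<open>Faithfulness enters here: if \<open>g\<close> and \<open>h\<close> agreed on every
  variable, \<open>inv g\<close> and \<open>inv h\<close> would act on \<open>V\<close> by the same
  matrix.\<close>

lemma pact_var_neq:
  assumes "g \<in> carrier G" "h \<in> carrier G" "g \<noteq> h"
  shows "\<exists>i<n. pact g (poly_var i) \<noteq> pact h (poly_var i)"
proof (rule ccontr)
  assume "\<not> ?thesis"
  then have "\<forall>i<n. lform g i = lform h i" by (simp add: pact_eq)
  then have cd: "cd (\<rho> (inv g) (b j)) i = cd (\<rho> (inv h) (b j)) i" if "i < n" "j < n" for i j
    using lookup_lform[OF that(2), of g i] lookup_lform[OF that(2), of h i] that(1) by simp
  have basis: "\<rho> (inv g) (b j) = \<rho> (inv h) (b j)" if "j < n" for j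
    using cd[OF _ that] by (subst (1 2) coord_expand) simp
  interpret L: Vector_Spaces.linear scale scale "\<rho> (inv g)" using linear_\<rho> assms by simp
  interpret L': Vector_Spaces.linear scale scale "\<rho> (inv h)" using linear_\<rho> assms by simp
  have "\<rho> (inv g) v = \<rho> (inv h) v" for v
    by (subst (1 2) coord_expand[of v]) (simp add: L.sum L'.sum L.scale L'.scale basis)
  then have "\<rho> (inv g) = \<rho> (inv h)" by blast
  then have "inv g = inv h" using faithful assms by (auto simp: inj_on_def)
  then show False using assms by (metis inv_inv)
qed

text \<open>Coefficients extracting the group element \<open>h\<close>: expand the product of
  \<open>g x\<^sub>u - u x\<^sub>u\<close> over all \<open>u \<noteq> h\<close>, where \<open>x\<^sub>u\<close> is a variable separating \<open>h\<close> from \<open>u\<close>.\<close>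

lemma exists_separating_combination:
  assumes h: "h \<in> carrier G"
  obtains F \<mu> D where "finite F" "F \<subseteq> poly_ring_le n (card (carrier G) - 1)"
    "\<forall>f\<in>F. \<mu> f \<in> poly_ring n" "D \<in> poly_ring n" "D \<noteq> 0"
    "\<forall>g\<in>carrier G. (\<Sum>f\<in>F. \<mu> f * pact g f) = (if g = h then D else 0)"
proof -
  define H where "H = carrier G - {h}"
  have finH: "finite H" using finite_carrier by (simp add: H_def)
  have "\<forall>u\<in>H. \<exists>i<n. pact h (poly_var i) \<noteq> pact u (poly_var i)"
    using pact_var_neq[OF h] by (auto simp: H_def)
  then obtain y where y: "\<And>u. u \<in> H \<Longrightarrow> y u < n"
      "\<And>u. u \<in> H \<Longrightarrow> pact h (poly_var (y u)) \<noteq> pact u (poly_var (y u))"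
    by metis
  \<comment> \<open>For \<open>g\<close> in the group other than \<open>h\<close> the factor with
    \<open>u = g\<close> vanishes; for \<open>g = h\<close> no factor does.\<close>
  define q where "q g = (\<Prod>u\<in>H. pact g (poly_var (y u)) + - pact u (poly_var (y u)))" for g
  define m where "m X = (\<Prod>u\<in>X. poly_var (y u) :: 'k polynomials)" for X
  define \<nu> where "\<nu> X = (\<Prod>u\<in>H - X. - pact u (poly_var (y u)))" for X
  define F where "F = m ` Pow H"
  \<comment> \<open>Separating variables may repeat, so different subsets can give the same
    monomial; \<open>\<mu>\<close> collects their coefficients.\<close>
  define \<mu> where "\<mu> f = (\<Sum>X\<in>{X \<in> Pow H. m X = f}. \<nu> X)" for f
  have var: "poly_var (y u) \<in> poly_ring_le n 1" if "u \<in> H" for u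
    using y(1)[OF that] by (rule poly_var_in)
  have pvar: "pact g (poly_var (y u)) \<in> poly_ring n" if "u \<in> H" for u g
    using var[OF that] poly_ring_le_subset pact_closed by blast
  note sub = subspace_poly_ring[of n, where 'k = 'k]
  have q_in: "q g \<in> poly_ring n" for g
    unfolding q_def using pvar by (intro poly_ring_prod pm.subspace_add[OF sub] pm.subspace_neg[OF sub])
  have expand: "(\<Sum>f\<in>F. \<mu> f * pact g f) = q g" for g
  proof -
    have "q g = (\<Sum>X\<in>Pow H. (\<Prod>u\<in>X. pact g (poly_var (y u))) * \<nu> X)"
      unfolding q_def \<nu>_def using finH by (rule prod_add)
    also have "\<dots> = (\<Sum>X\<in>Pow H. \<nu> X * pact g (m X))"
      by (simp add: m_def pact_prod mult.commute)
    also have "\<dots> = (\<Sum>f\<in>F. \<Sum>X\<in>{X \<in> Pow H. m X = f}. \<nu> X * pact g (m X))"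
      unfolding F_def using finH by (intro sum.image_gen) simp
    also have "\<dots> = (\<Sum>f\<in>F. \<mu> f * pact g f)"
      unfolding \<mu>_def sum_distrib_right by (intro sum.cong refl) auto
    finally show ?thesis by simp
  qed
  have "q g = 0" if "g \<in> carrier G" "g \<noteq> h" for g
    unfolding q_def using finH that by (intro prod_zero) (auto simp: H_def)
  moreover have "q h \<noteq> 0"
    unfolding q_def using finH y(2) by simp
  moreover have "F \<subseteq> poly_ring_le n (card (carrier G) - 1)"
  proof
    fix f assume "f \<in> F"
    then obtain X where X: "X \<subseteq> H" "f = m X" by (auto simp: F_def)
    have "m X \<in> poly_ring_le n (\<Sum>u\<in>X. 1)"
      unfolding m_def using X finH var by (intro poly_ring_le_prod) (auto intro: finite_subset)
    moreover have "(\<Sum>u\<in>X. 1) \<le> card (carrier G) - 1"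
      using card_mono[OF finH X(1)] h finite_carrier by (simp add: H_def)
    ultimately show "f \<in> poly_ring_le n (card (carrier G) - 1)"
      using poly_ring_le_mono X(2) by blast
  qed
  moreover have "\<mu> f \<in> poly_ring n" for f
    unfolding \<mu>_def \<nu>_def using pvar
    by (intro pm.subspace_sum[OF sub] poly_ring_prod pm.subspace_neg[OF sub]) auto
  moreover have "finite F" using finH by (simp add: F_def)
  ultimately show ?thesis
    using expand q_in by (intro that[of F \<mu> "q h"]) auto
qed

section \<open>Rational functions and the induced action\<close>

abbreviation ract :: "'g \<Rightarrow> 'k polynomials fract \<Rightarrow> 'k polynomials fract" where
  "ract \<equiv> ratfun_act G scale b n \<rho>"

abbreviation inv_ratfuns :: "'k polynomials fract set" where
  "inv_ratfuns \<equiv> invariant_ratfuns G scale b n \<rho>"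

lemma Fract_in: "p \<in> poly_ring n \<Longrightarrow> q \<in> poly_ring n \<Longrightarrow> q \<noteq> 0 \<Longrightarrow> Fract p q \<in> ratfuns n"
  by (auto simp: ratfuns_def)

text \<open>The value does not depend on the fraction chosen: \<open>pact g\<close> is
  multiplicative, so it preserves cross-multiplied equations, and it keeps denominators
  nonzero.\<close>

lemma ract_Fract:
  assumes g: "g \<in> carrier G" and pq: "p \<in> poly_ring n" "q \<in> poly_ring n" "q \<noteq> 0"
  shows "ract g (Fract p q) = Fract (pact g p) (pact g q)"
  unfolding ratfun_act_def
proof (rule the_equality)
  show "\<exists>p'\<in>poly_ring n. \<exists>q'\<in>poly_ring n. q' \<noteq> 0 \<and> Fract p q = Fract p' q' \<and>
     Fract (pact g p) (pact g q) = Fract (pact g p') (pact g q')"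
    using pq by blast
next
  fix s assume "\<exists>p'\<in>poly_ring n. \<exists>q'\<in>poly_ring n. q' \<noteq> 0 \<and> Fract p q = Fract p' q' \<and>
     s = Fract (pact g p') (pact g q')"
  then obtain p' q' where *: "p' \<in> poly_ring n" "q' \<in> poly_ring n" "q' \<noteq> 0"
    "Fract p q = Fract p' q'" "s = Fract (pact g p') (pact g q')" by blast
  then have "p * q' = p' * q" using pq by (simp add: eq_fract)
  then have "pact g p * pact g q' = pact g p' * pact g q" by (metis pact_mult)
  then show "s = Fract (pact g p) (pact g q)"
    using * pq g by (simp add: eq_fract pact_eq_0)
qed

lemma ratfunsE:
  assumes "r \<in> ratfuns n"
  obtains p q where "p \<in> poly_ring n" "q \<in> poly_ring n" "q \<noteq> 0" "r = Fract p q"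
  using assms by (auto simp: ratfuns_def)

lemma ratfuns_add: "r \<in> ratfuns n \<Longrightarrow> s \<in> ratfuns n \<Longrightarrow> r + s \<in> ratfuns n"
  by (elim ratfunsE)
    (auto intro!: Fract_in poly_ring_mult pm.subspace_add[OF subspace_poly_ring])

lemma ratfuns_mult: "r \<in> ratfuns n \<Longrightarrow> s \<in> ratfuns n \<Longrightarrow> r * s \<in> ratfuns n"
  by (elim ratfunsE) (auto intro!: Fract_in poly_ring_mult)

lemma ratfuns_sum: "(\<And>i. i \<in> I \<Longrightarrow> f i \<in> ratfuns n) \<Longrightarrow> sum f I \<in> ratfuns n"
proof (induction I rule: infinite_finite_induct)
  case (insert i I)
  then show ?case by (auto intro: ratfuns_add)
qed (auto simp: Zero_fract_def intro!: Fract_in pm.subspace_0[OF subspace_poly_ring])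

lemma ract_closed: "g \<in> carrier G \<Longrightarrow> r \<in> ratfuns n \<Longrightarrow> ract g r \<in> ratfuns n"
  by (elim ratfunsE) (auto simp: ract_Fract pact_eq_0 intro!: Fract_in pact_closed)

lemma ract_add:
  "g \<in> carrier G \<Longrightarrow> r \<in> ratfuns n \<Longrightarrow> s \<in> ratfuns n \<Longrightarrow> ract g (r + s) = ract g r + ract g s"
  by (elim ratfunsE)
    (simp add: ract_Fract pact_eq_0 poly_ring_mult pm.subspace_add[OF subspace_poly_ring] pact_closed pact_add pact_mult)

lemma ract_mult:
  "g \<in> carrier G \<Longrightarrow> r \<in> ratfuns n \<Longrightarrow> s \<in> ratfuns n \<Longrightarrow> ract g (r * s) = ract g r * ract g s"
  by (elim ratfunsE) (simp add: ract_Fract pact_eq_0 poly_ring_mult pact_mult)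

lemma ract_sum:
  assumes "g \<in> carrier G" "\<And>i. i \<in> I \<Longrightarrow> f i \<in> ratfuns n"
  shows "ract g (sum f I) = (\<Sum>i\<in>I. ract g (f i))"
proof -
  have zero: "ract g 0 = 0"
    using ract_Fract[OF assms(1), of 0 1] pm.subspace_0[OF subspace_poly_ring[of n, where 'k = 'k]]
    by (simp add: Zero_fract_def[symmetric])
  show ?thesis using assms(2)
  proof (induction I rule: infinite_finite_induct)
    case (insert i I)
    then show ?case using assms(1) by (simp add: ract_add ratfuns_sum)
  qed (auto simp: zero)
qed

lemma ract_ract:
  "g \<in> carrier G \<Longrightarrow> h \<in> carrier G \<Longrightarrow> r \<in> ratfuns n \<Longrightarrow> ract g (ract h r) = ract (g \<otimes> h) r"
  by (elim ratfunsE) (simp add: ract_Fract pact_eq_0 pact_closed pact_pact)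

lemma sum_Fract: "q \<noteq> 0 \<Longrightarrow> (\<Sum>i\<in>I. Fract (f i) q) = Fract (sum f I) q"
  for q :: "'k polynomials"
proof (induction I rule: infinite_finite_induct)
  case (insert i I)
  then show ?case by (simp add: eq_fract algebra_simps)
qed (auto simp: fract_collapse)

lemma trace_invariant:
  assumes "r \<in> ratfuns n"
  shows "(\<Sum>g\<in>carrier G. ract g r) \<in> inv_ratfuns"
  unfolding invariant_ratfuns_def
proof (intro CollectI conjI ballI)
  show "(\<Sum>g\<in>carrier G. ract g r) \<in> ratfuns n" using assms by (intro ratfuns_sum ract_closed)
  fix h assume h: "h \<in> carrier G"
  have bij: "bij_betw (\<lambda>g. h \<otimes> g) (carrier G) (carrier G)"
    using h by (intro bij_betwI[of _ _ _ "\<lambda>g. inv h \<otimes> g"]) (auto simp: m_assoc[symmetric])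
  have "ract h (\<Sum>g\<in>carrier G. ract g r) = (\<Sum>g\<in>carrier G. ract (h \<otimes> g) r)"
    using h assms by (subst ract_sum) (auto simp: ract_closed ract_ract)
  also have "\<dots> = (\<Sum>g\<in>carrier G. ract g r)"
    by (rule sum.reindex_bij_betw[OF bij])
  finally show "ract h (\<Sum>g\<in>carrier G. ract g r) = (\<Sum>g\<in>carrier G. ract g r)" .
qed

section \<open>Spanning over the invariants and relations between translates\<close>

definition spans_ratfuns :: "nat \<Rightarrow> bool" where
  "spans_ratfuns d \<longleftrightarrow> (\<forall>r \<in> (ratfuns n :: 'k polynomials fract set).
        \<exists>F c. finite F \<and> F \<subseteq> poly_ring_le n d \<and>
          (\<forall>f \<in> F. c f \<in> inv_ratfuns) \<and> r = (\<Sum>f \<in> F. c f * Fract f 1))"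

text \<open>If \<open>\<Sum>\<^sub>f \<mu> f * g f\<close> is \<open>D\<close> for \<open>g = \<one>\<close> and \<open>0\<close> otherwise, then the coefficient of \<open>f\<close> in \<open>r\<close>
  may be taken to be the trace of \<open>r * \<mu> f / D\<close>.\<close>

lemma spans_ratfuns_exists: "spans_ratfuns (card (carrier G) - 1)"
  unfolding spans_ratfuns_def
proof
  fix r :: "'k polynomials fract" assume r: "r \<in> ratfuns n"
  obtain F \<mu> D where F: "finite F" "F \<subseteq> poly_ring_le n (card (carrier G) - 1)"
    and \<mu>: "\<forall>f\<in>F. \<mu> f \<in> poly_ring n" and D: "D \<in> poly_ring n" "D \<noteq> 0"
    and delta: "\<forall>g\<in>carrier G. (\<Sum>f\<in>F. \<mu> f * pact g f) = (if g = \<one> then D else 0)"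
    by (rule exists_separating_combination[OF one_closed])
  define c where "c f = (\<Sum>g\<in>carrier G. ract g (r * Fract (\<mu> f) D))" for f
  have FR: "f \<in> poly_ring n" if "f \<in> F" for f using that F(2) poly_ring_le_subset by blast
  have q: "r * Fract (\<mu> f) D \<in> ratfuns n" if "f \<in> F" for f
    using r \<mu> that D by (auto intro: ratfuns_mult Fract_in)
  \<comment> \<open>Applying \<open>g\<close> to the separating relation at \<open>inv g\<close>
    moves the action from \<open>f\<close> to its coefficient, which is the form that occurs in the
    traces.\<close>
  have orth: "(\<Sum>f\<in>F. pact g (\<mu> f) * f) = (if g = \<one> then D else 0)" if g: "g \<in> carrier G" for g
  proof -
    have "(\<Sum>f\<in>F. pact g (\<mu> f) * f) = pact g (\<Sum>f\<in>F. \<mu> f * pact (inv g) f)"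
      using g FR by (simp add: pact_sum pact_mult pact_inv)
    then show ?thesis using bspec[OF delta, of "inv g"] g D
      by (simp add: inv_eq_1_iff pact_one split: if_splits)
  qed
  have "Fract D D = 1" using D by (simp add: One_fract_def eq_fract)
  \<comment> \<open>After the traces are expanded and the sums exchanged, only the summand at
    \<open>\<one>\<close> survives, and it equals \<open>r\<close>.\<close>
  have "(\<Sum>f\<in>F. c f * Fract f 1)
      = (\<Sum>f\<in>F. \<Sum>g\<in>carrier G. ract g r * Fract (pact g (\<mu> f) * f) (pact g D))"
    unfolding c_def sum_distrib_right using r \<mu> D
    by (intro sum.cong refl) (simp add: ract_mult ract_Fract Fract_in mult.assoc)
  also have "\<dots> = (\<Sum>g\<in>carrier G. ract g r * (\<Sum>f\<in>F. Fract (pact g (\<mu> f) * f) (pact g D)))"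
    unfolding sum_distrib_left by (rule sum.swap)
  also have "\<dots> = (\<Sum>g\<in>carrier G. if g = \<one> then ract \<one> r else 0)"
    using D orth \<open>Fract D D = 1\<close> by (intro sum.cong refl) (auto simp: sum_Fract pact_eq_0 pact_one fract_collapse)
  also have "\<dots> = ract \<one> r" using finite_carrier by simp
  also have "\<dots> = r" using r by (elim ratfunsE) (simp add: ract_Fract pact_one)
  finally have "r = (\<Sum>f\<in>F. c f * Fract f 1)" by simp
  moreover have "\<forall>f\<in>F. c f \<in> inv_ratfuns" using q trace_invariant by (simp add: c_def)
  ultimately show "\<exists>F c. finite F \<and> F \<subseteq> poly_ring_le n (card (carrier G) - 1) \<and>
      (\<forall>f\<in>F. c f \<in> inv_ratfuns) \<and> r = (\<Sum>f\<in>F. c f * Fract f 1)"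
    using F by blast
qed

text \<open>Invariant coefficients commute with the group, so the relation passes from degree at
  most \<open>d\<close> to all polynomials. This covers the separating combination, whose degree may
  exceed \<open>d\<close> and which isolates \<open>l h\<close>.\<close>

lemma translates_independent_if_spans:
  assumes span: "spans_ratfuns d"
    and rel: "\<And>f. f \<in> poly_ring_le n d \<Longrightarrow> (\<Sum>g\<in>carrier G. l g * pact g f) = 0"
    and h: "h \<in> carrier G"
  shows "l h = 0"
proof -
  have rel': "(\<Sum>g\<in>carrier G. l g * pact g p) = 0" if p: "p \<in> poly_ring n" for p
  proof -
    have "Fract p 1 \<in> ratfuns n" using p by (intro Fract_in) auto
    with span obtain F c where Fc: "finite F \<and> F \<subseteq> poly_ring_le n d \<and>
        (\<forall>f\<in>F. c f \<in> inv_ratfuns) \<and> Fract p 1 = (\<Sum>f\<in>F. c f * Fract f 1)"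
      unfolding spans_ratfuns_def by (elim ballE exE) auto
    note F = conjunct1[OF Fc] conjunct1[OF conjunct2[OF Fc]]
      and c = conjunct1[OF conjunct2[OF conjunct2[OF Fc]], THEN bspec]
      and eq = conjunct2[OF conjunct2[OF conjunct2[OF Fc]]]
    have FR: "f \<in> poly_ring n" if "f \<in> F" for f using that F(2) poly_ring_le_subset by blast
    have cR: "c f \<in> ratfuns n" "\<And>g. g \<in> carrier G \<Longrightarrow> ract g (c f) = c f" if "f \<in> F" for f
      using c[OF that] by (auto simp: invariant_ratfuns_def)
    \<comment> \<open>Invariance of the coefficients lets one expansion of \<open>p\<close> serve
      for all its translates.\<close>
    have act: "Fract (pact g p) 1 = (\<Sum>f\<in>F. c f * Fract (pact g f) 1)" if g: "g \<in> carrier G" for g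
    proof -
      have "Fract (pact g p) 1 = ract g (\<Sum>f\<in>F. c f * Fract f 1)"
        using ract_Fract[OF g p, of 1] eq by simp
      also have "\<dots> = (\<Sum>f\<in>F. ract g (c f * Fract f 1))"
        using g cR FR by (intro ract_sum ratfuns_mult Fract_in) auto
      also have "\<dots> = (\<Sum>f\<in>F. c f * Fract (pact g f) 1)"
        using g cR FR by (intro sum.cong refl) (simp add: ract_mult Fract_in ract_Fract)
      finally show ?thesis .
    qed
    have "Fract (\<Sum>g\<in>carrier G. l g * pact g p) 1 = (\<Sum>g\<in>carrier G. Fract (l g) 1 * Fract (pact g p) 1)"
      by (simp add: sum_Fract)
    also have "\<dots> = (\<Sum>g\<in>carrier G. \<Sum>f\<in>F. c f * Fract (l g * pact g f) 1)"
      by (intro sum.cong refl) (simp add: act sum_distrib_left mult.left_commute)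
    also have "\<dots> = (\<Sum>f\<in>F. c f * Fract (\<Sum>g\<in>carrier G. l g * pact g f) 1)"
      by (subst sum.swap) (simp add: sum_distrib_left[symmetric] sum_Fract)
    also have "\<dots> = 0"
      using F(2) rel by (intro sum.neutral) (auto simp: fract_collapse)
    finally show ?thesis by (simp add: Zero_fract_def eq_fract)
  qed
  obtain F \<mu> D where F: "finite F" "F \<subseteq> poly_ring_le n (card (carrier G) - 1)"
    and "\<forall>f\<in>F. \<mu> f \<in> poly_ring n" "D \<in> poly_ring n" and D: "D \<noteq> 0"
    and delta: "\<forall>g\<in>carrier G. (\<Sum>f\<in>F. \<mu> f * pact g f) = (if g = h then D else 0)"
    by (rule exists_separating_combination[OF h])
  \<comment> \<open>Weighting the relations by \<open>\<mu>\<close> leaves the single term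
    \<open>l h * D\<close>, with \<open>D\<close> nonzero.\<close>
  have "0 = (\<Sum>f\<in>F. \<mu> f * (\<Sum>g\<in>carrier G. l g * pact g f))"
    using F(2) poly_ring_le_subset rel' by (intro sum.neutral[symmetric]) fastforce
  also have "\<dots> = (\<Sum>g\<in>carrier G. l g * (\<Sum>f\<in>F. \<mu> f * pact g f))"
    unfolding sum_distrib_left by (subst sum.swap) (simp add: mult.left_commute)
  also have "\<dots> = (\<Sum>g\<in>carrier G. if g = h then l h * D else 0)"
    using delta by (intro sum.cong) auto
  also have "\<dots> = l h * D" using h finite_carrier by simp
  finally show ?thesis using D by simp
qed

end

section \<open>Comparing the degree bounds\<close>

text \<open>By freeness \<open>a \<mapsto> a f\<close> is injective, hence an isomorphism from
  \<open>kG\<close> onto the submodule generated by \<open>f\<close>.\<close>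

lemma (in group_rep) exists_regular_submodule:
  assumes f: "f \<in> M" and free: "\<forall>a\<in>regular_rep G. alg_act a f = 0 \<longrightarrow> a = 0"
  shows "\<exists>W\<subseteq>M. kG_submodule G scale act W \<and>
    kG_isomorphic G pm_scale (regular_act G) (regular_rep G :: ('g \<Rightarrow>\<^sub>0 'k) set) scale act W"
proof -
  note D = left_idealD[OF left_ideal_alg]
  let ?W = "(\<lambda>a. alg_act a f) ` alg"
  have inj: "a = c" if "a \<in> alg" "c \<in> alg" "alg_act a f = alg_act c f" for a c
    using free D(4)[OF that(1,2)] that(3) by (auto simp: alg_act_diff_left)
  have sub: "subspace ?W"
  proof (rule subspaceI)
    show "0 \<in> ?W" using D(2) alg_act_zero_left by (metis image_eqI)
    fix x y c assume x: "x \<in> ?W"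
    then obtain a where a: "a \<in> alg" "x = alg_act a f" by blast
    show "scale c x \<in> ?W" using a D(5) alg_act_scale_left by (metis image_eqI)
    assume "y \<in> ?W"
    then obtain a' where "a' \<in> alg" "y = alg_act a' f" by blast
    then show "x + y \<in> ?W" using a D(3) alg_act_add_left by (metis image_eqI)
  qed
  have "kG_submodule G scale act ?W"
    unfolding kG_submodule_def
  proof (intro conjI ballI)
    show "subspace ?W" by (rule sub)
    fix g x assume g: "g \<in> carrier G" and "x \<in> ?W"
    then obtain a where "a \<in> alg" "x = alg_act a f" by blast
    then show "act g x \<in> ?W" using g D(6) alg_act_regular_act f by (metis image_eqI)
  qed
  moreover have "kG_isomorphic G pm_scale (regular_act G) alg scale act ?W"
    unfolding kG_isomorphic_def using f inj
    by (intro exI[of _ "\<lambda>a. alg_act a f"])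
      (auto simp: bij_betw_def inj_on_def alg_act_add_left alg_act_scale_left alg_act_regular_act)
  moreover have "?W \<subseteq> M" using f alg_act_closed by blast
  ultimately show ?thesis by blast
qed

context polynomial_action
begin

lemma group_rep_poly_ring_le: "group_rep G pm_scale pact (poly_ring_le n d)"
  by (intro group_rep.intro group_rep_axioms.intro)
    (auto simp: vector_space_pm_scale group_axioms finite_carrier subspace_poly_ring_le
      pact_closed_le pact_add pact_scale pact_pact
      intro!: pact_one[OF subsetD[OF poly_ring_le_subset]])

definition contains_regular :: "nat \<Rightarrow> bool" where
  "contains_regular d \<longleftrightarrow> (\<exists>W \<subseteq> (poly_ring_le n d :: 'k polynomials set).
        kG_submodule G pm_scale pact W \<and>
        kG_isomorphic G
          pm_scale (regular_act G) (regular_rep G :: ('g \<Rightarrow>\<^sub>0 'k) set) pm_scale pact W)"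

lemma contains_regular_if_spans:
  assumes "spans_ratfuns d"
  shows "contains_regular d"
proof -
  interpret group_rep_idom G "pm_scale :: 'k \<Rightarrow> 'k polynomials \<Rightarrow> _" pact "poly_ring_le n d"
    using group_rep_poly_ring_le translates_independent_if_spans[OF assms]
    by (intro group_rep_idom.intro group_rep_idom_axioms.intro) (auto simp: pm_scale_mult_right)
  obtain f where "f \<in> poly_ring_le n d" "\<forall>a\<in>alg. alg_act a f = 0 \<longrightarrow> a = 0"
    using exists_free_vector by blast
  then show ?thesis
    unfolding contains_regular_def by (rule exists_regular_submodule)
qed

text \<open>The isomorphism sends the group elements to linearly independent polynomials of degree
  at most \<open>d\<close>, and these lie in the span of the monomials counted above.\<close>

lemma card_le_if_contains_regular:
  assumes "contains_regular d"
  shows "card (carrier G) \<le> (d + n) choose n"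
proof -
  obtain W \<phi> where W: "W \<subseteq> (poly_ring_le n d :: 'k polynomials set)"
    and \<phi>: "bij_betw \<phi> (regular_rep G :: ('g \<Rightarrow>\<^sub>0 'k) set) W"
    and add: "\<forall>u\<in>regular_rep G. \<forall>v\<in>regular_rep G. \<phi> (u + v) = \<phi> u + \<phi> v"
    and sc: "\<forall>c. \<forall>u\<in>regular_rep G. \<phi> (pm_scale c u) = pm_scale c (\<phi> u)"
    using assms unfolding contains_regular_def kG_isomorphic_def by blast
  note sub = subspace_regular_rep[of G, where 'k = 'k]
  define e where "e g = \<phi> (Poly_Mapping.single g 1)" for g
  have in_reg: "Poly_Mapping.single g c \<in> (regular_rep G :: ('g \<Rightarrow>\<^sub>0 'k) set)" if "g \<in> carrier G" for g c
    using that by (simp add: regular_rep_def)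
  have inj: "inj_on \<phi> (regular_rep G)" using \<phi> by (simp add: bij_betw_def)
  have inj_e: "inj_on e (carrier G)"
  proof (rule inj_onI)
    fix g h assume gh: "g \<in> carrier G" "h \<in> carrier G" "e g = e h"
    then have "Poly_Mapping.single g (1::'k) = Poly_Mapping.single h 1"
      using inj in_reg unfolding e_def by (auto dest: inj_onD)
    then show "g = h" by (metis keys_single one_neq_zero singleton_inject)
  qed
  have \<phi>0: "\<phi> 0 = 0" using add pm.subspace_0[OF sub] by (metis add_cancel_right_right)
  have \<phi>_sum: "\<phi> (sum f I) = (\<Sum>i\<in>I. \<phi> (f i))" if "\<And>i. i \<in> I \<Longrightarrow> f i \<in> regular_rep G" for f and I :: "'g set"
    using that
  proof (induction I rule: infinite_finite_induct)
    case (insert i I)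
    then show ?case using add pm.subspace_sum[OF sub, of I f] by simp
  qed (auto simp: \<phi>0)
  have "pm.independent (e ` carrier G)"
  proof (rule pm.independent_if_scalars_zero)
    show "finite (e ` carrier G)" using finite_carrier by simp
    fix u x assume zero: "(\<Sum>x\<in>e ` carrier G. pm_scale (u x) x) = 0" and "x \<in> e ` carrier G"
    then obtain h where h: "h \<in> carrier G" "x = e h" by blast
    \<comment> \<open>A relation between the \<open>e g\<close> is the image under
      \<open>\<phi>\<close> of this element of \<open>kG\<close>, which must therefore be
      \<open>0\<close>.\<close>
    define a where "a = (\<Sum>g\<in>carrier G. pm_scale (u (e g)) (Poly_Mapping.single g (1::'k)))"
    have a_in: "a \<in> regular_rep G"
      unfolding a_def using in_reg by (intro pm.subspace_sum[OF sub] pm.subspace_scale[OF sub])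
    have "\<phi> a = (\<Sum>g\<in>carrier G. pm_scale (u (e g)) (e g))"
      unfolding a_def using in_reg sc pm.subspace_scale[OF sub] by (subst \<phi>_sum) (auto simp: e_def)
    also have "\<dots> = 0" using zero inj_e by (simp add: sum.reindex)
    finally have "a = 0" using inj a_in \<phi>0 pm.subspace_0[OF sub] by (metis inj_onD)
    moreover have "Poly_Mapping.lookup a h = u (e h)"
      using h finite_carrier by (simp add: a_def lookup_sum lookup_single when_def if_distrib cong: if_cong)
    ultimately show "u x = 0" using h by simp
  qed
  moreover let ?Mon = "{m. Poly_Mapping.keys m \<subseteq> {..<n} \<and> mon_degree m \<le> d}"
  have "e ` carrier G \<subseteq> pm.span ((\<lambda>m. Poly_Mapping.single m (1::'k)) ` ?Mon)"
    unfolding poly_ring_le_span[symmetric] using W \<phi> in_reg by (auto simp: e_def bij_betw_def)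
  ultimately have "card (e ` carrier G) \<le> card ((\<lambda>m. Poly_Mapping.single m (1::'k)) ` ?Mon)"
    using pm.independent_span_bound[OF finite_imageI[OF finite_card_monomials(1)]] by blast
  also have "\<dots> \<le> card ?Mon" by (rule card_image_le[OF finite_card_monomials(1)])
  also have "\<dots> \<le> (d + n) choose n" by (rule finite_card_monomials(2))
  finally show ?thesis using inj_e by (simp add: card_image)
qed

end

theorem proposition4p9:
  fixes G :: "('g, 'm) monoid_scheme"
    and scale :: "'k::field \<Rightarrow> 'v::ab_group_add \<Rightarrow> 'v"
    and b :: "nat \<Rightarrow> 'v" and n :: nat
    and \<rho> :: "'g \<Rightarrow> 'v \<Rightarrow> 'v"
  assumes "Group.group G" and "finite (carrier G)"
    and "finite_dimensional_vector_space scale (b ` {..<n})" and "inj_on b {..<n}"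
    and "faithful_action G UNIV \<rho>"
    and "\<And>g. g \<in> carrier G \<Longrightarrow> Vector_Spaces.linear scale scale (\<rho> g)"
  shows "((D_span G scale b n \<rho> + n) choose n) \<ge> ((D_reg G scale b n \<rho> + n) choose n) \<and>
         ((D_reg G scale b n \<rho> + n) choose n) \<ge> card (carrier G)"
proof -
  interpret polynomial_action G scale b n \<rho>
    using assms by (intro polynomial_action.intro polynomial_action_axioms.intro)
  have span: "D_span G scale b n \<rho> = (LEAST d. spans_ratfuns d)"
    by (simp add: D_span_def spans_ratfuns_def)
  have reg: "D_reg G scale b n \<rho> = (LEAST d. contains_regular d)"
    by (simp add: D_reg_def contains_regular_def)
  \<comment> \<open>A \<open>LEAST\<close> has its defining property only if some degree has it;
    here \<open>card (carrier G) - 1\<close> is such a degree.\<close>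
  have c: "contains_regular (D_span G scale b n \<rho>)"
    unfolding span by (intro contains_regular_if_spans LeastI) (rule spans_ratfuns_exists)
  then have "D_reg G scale b n \<rho> \<le> D_span G scale b n \<rho>"
    unfolding reg by (rule Least_le)
  then have "(D_reg G scale b n \<rho> + n) choose n \<le> (D_span G scale b n \<rho> + n) choose n"
    by (intro binomial_right_mono) simp
  \<comment> \<open>The minimum defining \<open>D_reg\<close> is attained too, since
    \<open>c\<close> provides a degree with the property.\<close>
  moreover have "contains_regular (D_reg G scale b n \<rho>)"
    using c unfolding reg by (rule LeastI)
  ultimately show ?thesis using card_le_if_contains_regular by blast
qed

end
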